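(* Let $q$ be a prime power and let $C_m$ be a Hermitian code over $\mathbb{F}_{q^2}$ with $2q^2-2q-2\le m\le q^3+q^2-q-2$ (where $m$ is such that $\mathcal{B}$ contains a monomial of $w$-degree $m+1$). Let $(\mu,\beta)$ be the unique pair of non-negative integers with $m=\mu q+\beta(q+1)$ and $\mu\le q$ (then $\beta\ge q-2$), put $\lambda=\beta-q+2$, so that the distance of $C_m$ is $d=\mu q+\lambda(q+1)$, and let $x^ay^b$ be the unique monomial of $\mathcal{B}$ with $w$-degree $m+1$. (i) Let $D$ be an $\mathbb{F}_{q^2}$-divisor on $\mathcal{H}$ which is cut on $\mathcal{H}$ by the curve defined by a polynomial $F\in\mathbb{F}_{q^2}[x,y]$ with $\mathrm{LM}_\prec(F)=x^\mu y^\lambda$. Then $D$ is the support of a minimum-weight codeword of $C_m$. (ii) Let $D$ be an $\mathbb{F}_{q^2}$-divisor on $\mathcal{H}$ which is the support of a minimum-weight codeword of $C_m$. Then $\mathcal{N}(\mathrm{In}_\prec(I_D))$ contains only one monomial with $w$-degree larger than $m$, namely the monomial $x^ay^b$, whose $w$-degree is exactly $m+1$. Moreover, $D$ is cut on $\mathcal{H}$ by the curve defined by a polynomial $F\in\mathbb{F}_{q^2}[x,y]$ with $\mathrm{LM}_\prec(F)=x^\mu y^\lambda$.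
   Context: Let $q$ be a prime power. The Hermitian curve $\mathcal{H}$ is the curve in the affine plane over $\mathbb{F}_{q^2}$ defined by $H:=x^{q+1}-y^q-y$. It has exactly $n=q^3$ points $P_1,\dots,P_n$ with coordinates in $\mathbb{F}_{q^2}$; put $E=\{P_1,\dots,P_n\}$. The ideal of $E$ (as a reduced scheme) is $I_E=\langle H,\,x^{q^2}-x,\,y^{q^2}-y\rangle$ and $A_E=\mathbb{F}_{q^2}[x,y]/I_E$. An $\mathbb{F}_{q^2}$-divisor on $\mathcal{H}$ is a reduced zero-dimensional scheme $D$ consisting of pairwise distinct points of $E$ (identified with a subset of $E$); $I_D\subset\mathbb{F}_{q^2}[x,y]$ is its (radical, vanishing) ideal. A zero-dimensional scheme $D$ is said to be cut on $\mathcal{H}$ by the curve defined by $F$ if it is the scheme-theoretic (complete) intersection, i.e. $I_D=\langle H,F\rangle$. $\prec$ denotes the term ordering DegRevLex on $\mathbb{F}_{q^2}[x,y]$ with $y>x$: $x^ry^s\prec x^{r'}y^{s'}$ iff $r+s<r'+s'$, or $r+s=r'+s'$ and $r>r'$. $\mathrm{LM}_\prec(F)$ is the leading monomial of $F$, $\mathrm{In}_\prec(I)$ is the initial ideal of $I$, and $\mathcal{N}(\mathrm{In}_\prec(I))$ is the set of monomials not belonging to $\mathrm{In}_\prec(I)$. The $w$-degree of a monomial is $w(x^ry^s)=rq+s(q+1)$. The set $\mathcal{B}=\{x^ry^s : 0\le r\le q,\ 0\le s\le q^2-q-1\}\cup\{y^s : q^2-q\le s\le q^2-1\}$ is a monomial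 basis of $A_E$, and its elements have pairwise different $w$-degrees. For an integer $m\le q^3+q^2-q-2$ put $\mathcal{B}_m=\{x^ry^s\in\mathcal{B} : rq+s(q+1)\le m\}$. The Hermitian code $C_m\subseteq(\mathbb{F}_{q^2})^n$ is the dual code of the span of the vectors $(f(P_1),\dots,f(P_n))$, $f\in\mathcal{B}_m$. Convention: a code is labelled by the integer $m$ only if $\mathcal{B}$ contains a monomial of $w$-degree $m+1$. The support of a codeword $(c_1,\dots,c_n)$ is identified with the $\mathbb{F}_{q^2}$-divisor $\{P_i : c_i\ne0\}$. The distance of a code is the minimum weight of its non-zero codewords, and a minimum-weight codeword is a codeword whose weight equals the distance. *)

theory Defs
  imports
    "HOL-Analysis.Cartesian_Space"
    "HOL-Computational_Algebra.Polynomial"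
    "HOL-Number_Theory.Prime_Powers"
begin

text \<open>
  The ring $k[x,y]$ is \<^typ>\<open>'a poly poly\<close>: the outer variable is $y$, the coefficients are
  polynomials in $x$. A pair \<open>(r, s)\<close> of naturals stands for the monomial $x^r y^s$.
\<close>

definition xy_monom :: "nat \<times> nat \<Rightarrow> 'a::comm_semiring_1 poly poly" where
  "xy_monom = (\<lambda>(r, s). monom (monom 1 r) s)"

definition eval_xy :: "'a::comm_semiring_1 poly poly \<Rightarrow> 'a \<times> 'a \<Rightarrow> 'a" where
  "eval_xy F = (\<lambda>(x, y). poly (poly F [:y:]) x)"

definition xy_support :: "'a::zero poly poly \<Rightarrow> (nat \<times> nat) set" where
  "xy_support F = {(r, s). coeff (coeff F s) r \<noteq> 0}"

definition drl_less :: "nat \<times> nat \<Rightarrow> nat \<times> nat \<Rightarrow> bool" where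
  "drl_less = (\<lambda>(r, s) (r', s'). r + s < r' + s' \<or> (r + s = r' + s' \<and> r > r'))"

text \<open>
  A relation rather than a function, since the zero polynomial has no leading monomial:
  \<open>is_LM F u\<close> implies $F \neq 0$.
\<close>

definition is_LM :: "'a::zero poly poly \<Rightarrow> nat \<times> nat \<Rightarrow> bool" where
  "is_LM F u \<longleftrightarrow> u \<in> xy_support F \<and> (\<forall>v\<in>xy_support F. v \<noteq> u \<longrightarrow> drl_less v u)"

text \<open>An ideal is a submodule of the ring over itself.\<close>

definition ideal_gen :: "'r::comm_ring_1 set \<Rightarrow> 'r set" where
  "ideal_gen S = module.span (*) S"

definition initial_ideal :: "'a::comm_ring_1 poly poly set \<Rightarrow> 'a poly poly set" where
  "initial_ideal I = ideal_gen {xy_monom u | u. \<exists>F\<in>I. is_LM F u}"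

definition standard_monoms :: "'a::comm_ring_1 poly poly set \<Rightarrow> (nat \<times> nat) set" where
  "standard_monoms J = {u. xy_monom u \<notin> J}"

definition vanishing_ideal :: "('a::comm_ring_1 \<times> 'a) set \<Rightarrow> 'a poly poly set" where
  "vanishing_ideal D = {F. \<forall>P\<in>D. eval_xy F P = 0}"


definition hermitian_poly :: "nat \<Rightarrow> 'a::comm_ring_1 poly poly" where
  "hermitian_poly q = xy_monom (q + 1, 0) - xy_monom (0, q) - xy_monom (0, 1)"

definition hermitian_points :: "nat \<Rightarrow> ('a::comm_ring_1 \<times> 'a) set" where
  "hermitian_points q = {P. eval_xy (hermitian_poly q) P = 0}"

definition hermitian_divisor :: "nat \<Rightarrow> ('a::comm_ring_1 \<times> 'a) set \<Rightarrow> bool" where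
  "hermitian_divisor q D \<longleftrightarrow> D \<subseteq> hermitian_points q"

text \<open>Equality of ideals, so the intersection with the curve is scheme-theoretic.\<close>

definition cut_on_hermitian ::
  "nat \<Rightarrow> ('a::comm_ring_1 \<times> 'a) set \<Rightarrow> 'a poly poly \<Rightarrow> bool" where
  "cut_on_hermitian q D F \<longleftrightarrow> vanishing_ideal D = ideal_gen {hermitian_poly q, F}"

definition wdeg :: "nat \<Rightarrow> nat \<times> nat \<Rightarrow> nat" where
  "wdeg q = (\<lambda>(r, s). r * q + s * (q + 1))"

definition basis_monoms :: "nat \<Rightarrow> (nat \<times> nat) set" where
  "basis_monoms q =
     {(r, s). r \<le> q \<and> s \<le> q^2 - q - 1} \<union> {(0, s) | s. q^2 - q \<le> s \<and> s \<le> q^2 - 1}"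

definition basis_monoms_upto :: "nat \<Rightarrow> nat \<Rightarrow> (nat \<times> nat) set" where
  "basis_monoms_upto q m = {u \<in> basis_monoms q. wdeg q u \<le> m}"


definition dual_code :: "('a::field ^ 'n::finite) set \<Rightarrow> ('a ^ 'n) set" where
  "dual_code V = {c. \<forall>v\<in>V. (\<Sum>i\<in>UNIV. c $ i * v $ i) = 0}"

text \<open>\<open>P\<close> is the enumeration of the rational points that indexes the coordinates.\<close>

definition hermitian_code ::
  "nat \<Rightarrow> ('n::finite \<Rightarrow> 'a::field \<times> 'a) \<Rightarrow> nat \<Rightarrow> ('a ^ 'n) set" where
  "hermitian_code q P m =
     dual_code (vec.span ((\<lambda>u. \<chi> i. eval_xy (xy_monom u) (P i)) ` basis_monoms_upto q m))"

definition weight :: "'a::zero ^ 'n::finite \<Rightarrow> nat" where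
  "weight c = card {i. c $ i \<noteq> 0}"

definition code_distance :: "('a::zero ^ 'n::finite) set \<Rightarrow> nat" where
  "code_distance C = Inf (weight ` (C - {0}))"

definition min_weight_codeword :: "('a::zero ^ 'n::finite) set \<Rightarrow> 'a ^ 'n \<Rightarrow> bool" where
  "min_weight_codeword C c \<longleftrightarrow> c \<in> C - {0} \<and> weight c = code_distance C"

definition codeword_support ::
  "('n::finite \<Rightarrow> 'a::zero \<times> 'a) \<Rightarrow> 'a ^ 'n \<Rightarrow> ('a \<times> 'a) set" where
  "codeword_support P c = P ` {i. c $ i \<noteq> 0}"

end

theory Submission
  imports Defs
begin

text \<open>
  Give $x$ weight $q$ and $y$ weight $q+1$. The two monomials $x^{q+1}$ and $y^q$ of the Hermitian
  polynomial $H$ have the same weight and the third one is lighter, so every polynomial is congruent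
  modulo $H$ to one in the monomials $x^r y^s$ with $r \<le> q$ (called reduced below), and this
  rewriting never raises the weight. Reduced monomials have pairwise different weights, and on them
  comparing weights is the same as comparing in DegRevLex (\<open>wdeg_inj_reduced\<close>,
  \<open>drl_less_iff_wdeg\<close>). Hence for a set $D$ of rational points the standard monomials of $I_D$ are
  the reduced monomials whose weight is not the leading weight of any element of $I_D$
  (\<open>standard_monoms_eq_footprint\<close>). This set, the footprint of $D$, has $|D|$ elements
  (\<open>card_footprint\<close>), and the leading weights are closed under adding elements of the semigroup
  generated by $q$ and $q+1$.

  That semigroup is symmetric with largest gap $q^2-q-1$. If a monomial of large weight $v$ lies in
  the footprint, so does every reduced monomial whose weight can be completed to $v$ inside the
  semigroup. By symmetry these are exactly the reduced monomials whose weight is not of the form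
  $e + s$ with $s$ in the semigroup, for $e = v - (q^2-q-1)$. They form a staircase region with two steps
  and $e$ elements (\<open>staircase_subset_footprint\<close>, \<open>card_staircase_corner\<close>).

  Now let $c$ be a nonzero codeword of $C_m$ with support $D$. It is a functional on functions on $D$
  that kills all monomials of weight at most $m$. If the footprint contained only such monomials,
  they would span all functions on $D$ and $c$ would be zero. So some standard monomial has weight
  $v \<ge> m+1$, whence $|D| \<ge> v - (q^2-q-1) \<ge> d$ with $d = \<mu> q + l(q+1)$. In the
  case of equality $v = m+1$, the monomial is $x^a y^b$, no other standard monomial is that heavy,
  and the footprint is precisely the staircase with corner $x^\<mu> y^l$
  (\<open>footprint_of_extremal_support\<close>). Since the corner is not in the footprint, it is the leading
  monomial of some $F \<in> I_D$. The leading weights of $I_D$ are then those of the multiples of $F$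
  modulo $H$, and division with remainder gives $I_D = \<langle>H, F\<rangle>$
  (\<open>vanishing_ideal_cut\<close>).

  Conversely, if $I_D = \<langle>H,F\<rangle>$ with leading monomial $x^\<mu> y^l$, leading
  weights of $I_D$ are leading weights of multiples of $F$, so the footprint is again that staircase
  (\<open>cut_footprint\<close>) and $|D| = d$. As $x^a y^b$ is a standard monomial, some functional on $D$ kills
  all smaller weights but not $x^a y^b$. It is a codeword supported inside $D$, and by the lower
  bound its support is all of $D$ (\<open>full_support_functional\<close>). That $d$ is attained for every $m$
  follows by taking for $D$ the rational points on $\<mu>$ vertical and $l$ horizontal lines
  that do not meet on the curve (\<open>exists_extremal_divisor\<close>).
\<close>

section \<open>Coefficients and evaluation of bivariate polynomials\<close>

definition xy_coeff :: "'a::zero poly poly \<Rightarrow> nat \<times> nat \<Rightarrow> 'a" where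
  "xy_coeff F u = coeff (coeff F (snd u)) (fst u)"

text \<open>
  Constants of the ring are polynomials in both variables, so an element of the field acts through
  a constant coefficient polynomial.
\<close>
abbreviation scale_xy :: "'a::comm_semiring_0 \<Rightarrow> 'a poly poly \<Rightarrow> 'a poly poly" where
  "scale_xy c F \<equiv> smult [:c:] F"

lemma xy_support_eq: "xy_support F = {u. xy_coeff F u \<noteq> 0}"
  by (auto simp: xy_support_def xy_coeff_def)

lemma xy_coeff_0 [simp]: "xy_coeff 0 u = 0"
  and xy_coeff_add [simp]: "xy_coeff (F + G) u = xy_coeff F u + xy_coeff G u"
  for F G :: "'a::comm_monoid_add poly poly"
  by (simp_all add: xy_coeff_def)

lemma xy_coeff_diff [simp]: "xy_coeff (F - G) u = xy_coeff F u - xy_coeff G u"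
  for F G :: "'a::ab_group_add poly poly"
  by (simp add: xy_coeff_def)

lemma xy_coeff_scale [simp]: "xy_coeff (scale_xy c F) u = c * xy_coeff F u"
  for F :: "'a::comm_semiring_0 poly poly"
  by (simp add: xy_coeff_def)

lemma xy_coeff_sum: "xy_coeff (\<Sum>i\<in>A. f i) u = (\<Sum>i\<in>A. xy_coeff (f i) u)"
  for f :: "_ \<Rightarrow> 'a::comm_monoid_add poly poly"
  by (simp add: xy_coeff_def coeff_sum)

lemma xy_coeff_monom: "xy_coeff (xy_monom u :: 'a::comm_semiring_1 poly poly) v = (if u = v then 1 else 0)"
  by (cases u; cases v) (auto simp: xy_coeff_def xy_monom_def)

lemma xy_coeff_monom_mult:
  "xy_coeff (xy_monom (r, s) * F) (r', s') = (if r \<le> r' \<and> s \<le> s' then xy_coeff F (r' - r, s' - s) else 0)"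
  for F :: "'a::comm_semiring_1 poly poly"
  by (auto simp: xy_coeff_def xy_monom_def coeff_monom_mult)

lemma xy_coeff_eqI: "(\<And>u. xy_coeff F u = xy_coeff G u) \<Longrightarrow> F = G"
  unfolding xy_coeff_def by (intro poly_eqI) (metis fst_conv snd_conv)

lemma xy_monom_mult: "xy_monom u * xy_monom v = (xy_monom (u + v) :: 'a::comm_semiring_1 poly poly)"
  by (cases u; cases v) (auto simp: xy_monom_def mult_monom)

lemma finite_xy_support [simp]: "finite (xy_support F)"
proof (rule finite_subset)
  show "xy_support F \<subseteq> (\<Union>s\<in>{..degree F}. (\<lambda>r. (r, s)) ` {..degree (coeff F s)})"
    by (auto simp: xy_support_def image_iff intro!: le_degree)
qed auto

lemma xy_expansion:
  "F = (\<Sum>u\<in>xy_support F. scale_xy (xy_coeff F u) (xy_monom u))" for F :: "'a::comm_ring_1 poly poly"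
proof (rule xy_coeff_eqI)
  fix v
  have "(\<Sum>u\<in>xy_support F. xy_coeff F u * (if u = v then 1 else 0))
      = (\<Sum>u\<in>xy_support F. if u = v then xy_coeff F u else 0)"
    by (rule sum.cong) auto
  then show "xy_coeff F v = xy_coeff (\<Sum>u\<in>xy_support F. scale_xy (xy_coeff F u) (xy_monom u)) v"
    by (simp add: xy_coeff_sum xy_coeff_monom sum.delta) (simp add: xy_support_eq)
qed

lemma eval_xy_add [simp]: "eval_xy (F + G) p = eval_xy F p + eval_xy G p"
  and eval_xy_mult [simp]: "eval_xy (F * G) p = eval_xy F p * eval_xy G p"
  and eval_xy_0 [simp]: "eval_xy 0 p = 0"
  and eval_xy_1 [simp]: "eval_xy 1 p = 1"
  and eval_xy_scale [simp]: "eval_xy (scale_xy c F) p = c * eval_xy F p"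
  for F G :: "'a::comm_semiring_1 poly poly"
  by (simp_all add: eval_xy_def split: prod.splits)

lemma eval_xy_diff [simp]: "eval_xy (F - G) p = eval_xy F p - eval_xy G p"
  for F G :: "'a::comm_ring_1 poly poly"
  by (simp add: eval_xy_def split: prod.splits)

lemma eval_xy_prod: "eval_xy (\<Prod>i\<in>A. f i) p = (\<Prod>i\<in>A. eval_xy (f i) p)"
  for f :: "_ \<Rightarrow> 'a::comm_semiring_1 poly poly"
  by (induction A rule: infinite_finite_induct) auto

lemma eval_xy_monom: "eval_xy (xy_monom (r, s)) (x, y) = x ^ r * y ^ s"
  for x :: "'a::comm_semiring_1"
  by (simp add: eval_xy_def xy_monom_def poly_monom poly_power)

lemma mem_hermitian_points: "(x, y) \<in> hermitian_points q \<longleftrightarrow> y ^ q + y = x ^ (q + 1)"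
  for x :: "'a::comm_ring_1"
  by (auto simp: hermitian_points_def hermitian_poly_def eval_xy_monom algebra_simps)

lemma module_self: "module ((*) :: 'r::comm_ring_1 \<Rightarrow> 'r \<Rightarrow> 'r)"
  by unfold_locales (simp_all add: algebra_simps)

lemma mem_ideal_gen_pair: "f \<in> ideal_gen {H, F} \<longleftrightarrow> (\<exists>g h. f = g * H + h * F)"
  unfolding ideal_gen_def module.span_breakdown_eq[OF module_self] module.span_empty[OF module_self]
  by (auto simp: algebra_simps)

section \<open>Weights and reduction modulo the Hermitian polynomial\<close>

definition wdeg_below :: "nat \<Rightarrow> nat \<Rightarrow> 'a::zero poly poly \<Rightarrow> bool" where
  "wdeg_below q t F \<longleftrightarrow> (\<forall>u. xy_coeff F u \<noteq> 0 \<longrightarrow> wdeg q u < t)"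

text \<open>
  Only the part of $F$ of top weight is prescribed: it is the single monomial \<open>u\<close>. This tolerates
  monomials $x^r y^s$ with $r > q$ of smaller weight, for which weight and DegRevLex may disagree.
\<close>
definition wmonic :: "nat \<Rightarrow> nat \<times> nat \<Rightarrow> 'a::comm_ring_1 poly poly \<Rightarrow> bool" where
  "wmonic q u F \<longleftrightarrow> wdeg_below q (wdeg q u) (F - xy_monom u)"

definition reduced_monoms :: "nat \<Rightarrow> (nat \<times> nat) set" where
  "reduced_monoms q = {(r, s). r \<le> q}"

definition reduced :: "nat \<Rightarrow> 'a::zero poly poly \<Rightarrow> bool" where
  "reduced q F \<longleftrightarrow> xy_support F \<subseteq> reduced_monoms q"

lemma wdeg_add: "wdeg q (u + v) = wdeg q u + wdeg q v"
  by (cases u; cases v) (simp add: wdeg_def algebra_simps)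

lemma wdeg_below_mono: "wdeg_below q t F \<Longrightarrow> t \<le> t' \<Longrightarrow> wdeg_below q t' F"
  unfolding wdeg_below_def by (meson less_le_trans)

lemma ex_wdeg_below: "\<exists>t. wdeg_below q t F"
proof
  show "wdeg_below q (Suc (Max (wdeg q ` xy_support F))) F"
    unfolding wdeg_below_def by (auto simp: less_Suc_eq_le xy_support_eq[symmetric] intro!: Max_ge)
      (simp add: xy_support_eq)
qed

lemma wdeg_below_0 [simp]: "wdeg_below q t 0"
  by (simp add: wdeg_below_def)

lemma wdeg_below_add: "wdeg_below q t F \<Longrightarrow> wdeg_below q t G \<Longrightarrow> wdeg_below q t (F + G)"
  for F :: "'a::comm_ring_1 poly poly"
  unfolding wdeg_below_def by (metis add.left_neutral xy_coeff_add)

lemma wdeg_below_scale: "wdeg_below q t F \<Longrightarrow> wdeg_below q t (scale_xy c F)"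
  for F :: "'a::comm_ring_1 poly poly"
  unfolding wdeg_below_def by (metis mult_zero_right xy_coeff_scale)

lemma wdeg_below_diff: "wdeg_below q t F \<Longrightarrow> wdeg_below q t G \<Longrightarrow> wdeg_below q t (F - G)"
  for F :: "'a::comm_ring_1 poly poly"
  unfolding wdeg_below_def by (metis diff_0_right xy_coeff_diff)

lemma wdeg_below_sum: "(\<And>i. i \<in> A \<Longrightarrow> wdeg_below q t (f i)) \<Longrightarrow> wdeg_below q t (\<Sum>i\<in>A. f i)"
  for f :: "_ \<Rightarrow> 'a::comm_ring_1 poly poly"
  by (induction A rule: infinite_finite_induct) (auto intro: wdeg_below_add)

lemma wdeg_below_monom: "wdeg q u < t \<Longrightarrow> wdeg_below q t (xy_monom u :: 'a::comm_ring_1 poly poly)"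
  by (auto simp: wdeg_below_def xy_coeff_monom)

lemma wdeg_below_monom_mult: "wdeg_below q t F \<Longrightarrow> wdeg_below q (wdeg q u + t) (xy_monom u * F)"
  for F :: "'a::comm_ring_1 poly poly"
proof (unfold wdeg_below_def, intro allI impI)
  fix v assume F: "\<forall>u. xy_coeff F u \<noteq> 0 \<longrightarrow> wdeg q u < t" and nz: "xy_coeff (xy_monom u * F) v \<noteq> 0"
  obtain r s r' s' where uv: "u = (r, s)" "v = (r', s')" by (metis surj_pair)
  with nz have le: "r \<le> r'" "s \<le> s'" "xy_coeff F (r' - r, s' - s) \<noteq> 0"
    by (auto simp: xy_coeff_monom_mult split: if_splits)
  then have "v = u + (r' - r, s' - s)" by (simp add: uv)
  then show "wdeg q v < wdeg q u + t" using F le(3) by (metis add_strict_left_mono wdeg_add)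
qed

lemma wdeg_below_mult:
  fixes F G :: "'a::comm_ring_1 poly poly"
  assumes F: "\<And>u. u \<in> xy_support F \<Longrightarrow> wdeg q u \<le> t" and G: "wdeg_below q t' G"
  shows "wdeg_below q (t + t') (F * G)"
proof -
  have "F * G = (\<Sum>u\<in>xy_support F. scale_xy (xy_coeff F u) (xy_monom u * G))"
    by (subst xy_expansion[of F], subst sum_distrib_right) (simp only: mult_smult_left)
  moreover have "wdeg_below q (t + t') (scale_xy (xy_coeff F u) (xy_monom u * G))" if "u \<in> xy_support F" for u
    by (intro wdeg_below_scale wdeg_below_mono[OF wdeg_below_monom_mult[OF G]]) (use F[OF that] in simp)
  ultimately show ?thesis by (metis (no_types, lifting) wdeg_below_sum)
qed

lemma wmonic_mult:
  fixes F G :: "'a::comm_ring_1 poly poly"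
  assumes F: "wmonic q u F" and G: "wmonic q v G"
  shows "wmonic q (u + v) (F * G)"
proof -
  have F': "wdeg q x \<le> wdeg q u" if "x \<in> xy_support F" for x
  proof (cases "x = u")
    case False
    then have "xy_coeff (F - xy_monom u) x \<noteq> 0" using that by (simp add: xy_coeff_monom xy_support_eq)
    then show ?thesis using F unfolding wmonic_def wdeg_below_def by (meson less_imp_le)
  qed simp
  have "F * G - xy_monom (u + v) = F * (G - xy_monom v) + xy_monom v * (F - xy_monom u)"
    by (simp add: algebra_simps xy_monom_mult add.commute)
  moreover have "wdeg_below q (wdeg q u + wdeg q v) (F * (G - xy_monom v))"
    using wdeg_below_mult[OF F'] G by (simp add: wmonic_def)
  moreover have "wdeg_below q (wdeg q u + wdeg q v) (xy_monom v * (F - xy_monom u))"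
    using wdeg_below_monom_mult F unfolding wmonic_def by (metis add.commute)
  ultimately show ?thesis by (simp add: wmonic_def wdeg_add wdeg_below_add)
qed

lemma wmonic_monom: "wmonic q u (xy_monom u)"
  by (simp add: wmonic_def)

lemma reduced_0: "reduced q 0"
  by (simp add: reduced_def xy_support_eq)

lemma reduced_add: "reduced q F \<Longrightarrow> reduced q G \<Longrightarrow> reduced q (F + G)"
  for F :: "'a::comm_ring_1 poly poly"
  unfolding reduced_def xy_support_eq subset_iff mem_Collect_eq by (metis add_0 xy_coeff_add)

lemma reduced_diff: "reduced q F \<Longrightarrow> reduced q G \<Longrightarrow> reduced q (F - G)"
  for F :: "'a::comm_ring_1 poly poly"
  unfolding reduced_def xy_support_eq subset_iff mem_Collect_eq by (metis diff_self xy_coeff_diff)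

lemma reduced_scale: "reduced q F \<Longrightarrow> reduced q (scale_xy c F)"
  for F :: "'a::comm_ring_1 poly poly"
  unfolding reduced_def xy_support_eq subset_iff mem_Collect_eq by (metis mult_zero_right xy_coeff_scale)

lemma reduced_sum: "(\<And>i. i \<in> A \<Longrightarrow> reduced q (f i)) \<Longrightarrow> reduced q (\<Sum>i\<in>A. f i)"
  for f :: "_ \<Rightarrow> 'a::comm_ring_1 poly poly"
  by (induction A rule: infinite_finite_induct) (auto intro: reduced_0 reduced_add)

lemma reduced_monom: "u \<in> reduced_monoms q \<Longrightarrow> reduced q (xy_monom u :: 'a::comm_ring_1 poly poly)"
  by (auto simp: reduced_def xy_support_eq xy_coeff_monom)

text \<open>
  Since $q \<equiv> -1$ modulo $q+1$, the weight of $x^r y^s$ determines $r$ modulo $q+1$, hence $r$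
  itself when $r \<le> q$.
\<close>
lemma wdeg_inj_reduced: "inj_on (wdeg q) (reduced_monoms q)"
proof (rule inj_onI)
  fix u v assume uv: "u \<in> reduced_monoms q" "v \<in> reduced_monoms q" "wdeg q u = wdeg q v"
  obtain r s r' s' where [simp]: "u = (r, s)" "v = (r', s')" by (metis surj_pair)
  have le: "r \<le> q" "r' \<le> q" using uv by (auto simp: reduced_monoms_def)
  have "int r * q + s * (q + 1) = int r' * q + s' * (q + 1)"
    using uv(3) unfolding wdeg_def by (simp flip: of_nat_mult of_nat_add) 
  then have "(int r' - r) = (int r' - r + s' - s) * (q + 1)"
    by (simp add: algebra_simps)
  then have "(int q + 1) dvd (int r' - r)" by (metis dvd_triv_right of_nat_1 of_nat_add)
  moreover have "\<bar>int r' - r\<bar> < int q + 1" using le by linarith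
  ultimately have "int r' - r = 0" using dvd_imp_le_int[of "int r' - int r" "int q + 1"] by auto
  then have "r = r'" by simp
  then have "s * (q + 1) = s' * (q + 1)" using uv(3) by (simp add: wdeg_def)
  then show "u = v" using \<open>r = r'\<close> by (metis Suc_eq_plus1 Suc_mult_cancel1 mult.commute \<open>u = (r, s)\<close> \<open>v = (r', s')\<close>)
qed

text \<open>
  The weight of $x^r y^s$ is $(r+s)(q+1) - r$. For $r \<le> q$ the correction $r$ is smaller than the
  step $q+1$ between consecutive total degrees, so it only acts as the tie-breaker of DegRevLex.
\<close>
lemma drl_less_iff_wdeg:
  assumes "v \<in> reduced_monoms q" "u \<in> reduced_monoms q"
  shows "drl_less v u \<longleftrightarrow> wdeg q v < wdeg q u"
proof -
  obtain r s r' s' where [simp]: "u = (r, s)" "v = (r', s')" by (metis surj_pair)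
  have le: "r \<le> q" "r' \<le> q" using assms by (auto simp: reduced_monoms_def)
  have wu: "wdeg q u + r = (r + s) * (q + 1)" and wv: "wdeg q v + r' = (r' + s') * (q + 1)"
    by (simp_all add: wdeg_def algebra_simps)
  consider "r' + s' < r + s" | "r' + s' = r + s" | "r' + s' > r + s" by linarith
  then show ?thesis
  proof cases
    case 1
    then have "(r' + s' + 1) * (q + 1) \<le> (r + s) * (q + 1)" by (intro mult_right_mono) auto
    then have "wdeg q v < wdeg q u" using wu wv le by simp
    then show ?thesis using 1 by (simp add: drl_less_def)
  next
    case 2
    then show ?thesis using wu wv by (auto simp: drl_less_def)
  next
    case 3
    then have "(r + s + 1) * (q + 1) \<le> (r' + s') * (q + 1)" by (intro mult_right_mono) auto
    then have "wdeg q u < wdeg q v" using wu wv le by simp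
    then show ?thesis using 3 by (simp add: drl_less_def)
  qed
qed

text \<open>
  The correction $r$ of the smaller monomial may be arbitrarily large here; it only lowers its weight.
\<close>
lemma drl_less_imp_wdeg_less:
  assumes "drl_less v u" "u \<in> reduced_monoms q"
  shows "wdeg q v < wdeg q u"
proof -
  obtain r s r' s' where [simp]: "u = (r, s)" "v = (r', s')" by (metis surj_pair)
  have le: "r \<le> q" using assms by (auto simp: reduced_monoms_def)
  have wu: "wdeg q u + r = (r + s) * (q + 1)" and wv: "wdeg q v + r' = (r' + s') * (q + 1)"
    by (simp_all add: wdeg_def algebra_simps)
  show ?thesis
  proof (cases "r' + s' < r + s")
    case True
    then have "(r' + s' + 1) * (q + 1) \<le> (r + s) * (q + 1)" by (intro mult_right_mono) auto
    then show "wdeg q v < wdeg q u" using wu wv le by simp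
  next
    case False
    then have "r' + s' = r + s" "r < r'" using assms(1) by (auto simp: drl_less_def)
    then show ?thesis using wu wv by simp
  qed
qed

text \<open>
  Replacing $x^{q+1}$ by $y^q + y$ keeps the weight in the term with $y^q$ and lowers it in the
  term with $y$.
\<close>
lemma monom_reduction:
  assumes q: "2 \<le> q"
  shows "\<exists>u\<in>reduced_monoms q. wdeg q u = wdeg q (r, s) \<and>
     (\<exists>g. reduced q g \<and> wdeg_below q (wdeg q u) g \<and>
        hermitian_poly q dvd (xy_monom (r, s) - (xy_monom u + g)))"
  (is "\<exists>u\<in>_. _ \<and> (\<exists>g::'a::comm_ring_1 poly poly. _ \<and> _ \<and> ?H dvd _)")
proof (induction r arbitrary: s rule: less_induct)
  case (less r)
  show ?case
  proof (cases "r \<le> q")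
    case True
    then show ?thesis by (intro bexI[of _ "(r, s)"] conjI exI[of _ 0])
        (auto simp: reduced_monoms_def reduced_0)
  next
    case False
    define r' where "r' = r - (q + 1)"
    have r: "r = r' + (q + 1)" "r' < r" using False by (auto simp: r'_def)
    obtain u g where u: "u \<in> reduced_monoms q" "wdeg q u = wdeg q (r', s + q)"
        "reduced q g" "wdeg_below q (wdeg q u) g" "?H dvd (xy_monom (r', s + q) - (xy_monom u + g))"
      using less[OF r(2)] by blast
    obtain v h where v: "v \<in> reduced_monoms q" "wdeg q v = wdeg q (r', s + 1)"
        "reduced q h" "wdeg_below q (wdeg q v) h" "?H dvd (xy_monom (r', s + 1) - (xy_monom v + h))"
      using less[OF r(2)] by blast
    have "xy_monom (r', s) * ?H = xy_monom (r, s) - xy_monom (r', s + q) - xy_monom (r', s + 1)"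
      by (simp add: hermitian_poly_def right_diff_distrib xy_monom_mult r)
    then have "xy_monom (r, s) - (xy_monom u + (g + (xy_monom v + h)))
        = xy_monom (r', s) * ?H + (xy_monom (r', s + q) - (xy_monom u + g))
          + (xy_monom (r', s + 1) - (xy_monom v + h))"
      by (simp add: algebra_simps)
    then have "?H dvd xy_monom (r, s) - (xy_monom u + (g + (xy_monom v + h)))"
      by (simp only:) (intro dvd_add dvd_triv_right u(5) v(5))
    moreover have wu: "wdeg q u = wdeg q (r, s)" unfolding u(2) r by (simp add: wdeg_def algebra_simps)
    moreover have "reduced q (g + (xy_monom v + h))"
      by (intro reduced_add u v reduced_monom)
    moreover have "wdeg_below q (wdeg q u) (g + (xy_monom v + h))"
    proof -
      have "(s + 1) * (q + 1) < (s + q) * (q + 1)" using q by (intro mult_strict_right_mono) auto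
      then have "wdeg q v < wdeg q u" unfolding u(2) v(2) by (simp add: wdeg_def)
      then show ?thesis
        by (intro wdeg_below_add u(4) wdeg_below_monom) (auto intro: wdeg_below_mono[OF v(4)])
    qed
    ultimately show ?thesis using u(1) by blast
  qed
qed

lemma poly_reduction:
  fixes F :: "'a::comm_ring_1 poly poly"
  assumes q: "2 \<le> q" and F: "wdeg_below q t F"
  obtains G where "reduced q G" "wdeg_below q t G" "hermitian_poly q dvd (F - G)"
proof -
  have "\<exists>N. reduced q N \<and> wdeg_below q (wdeg q u + 1) N \<and> hermitian_poly q dvd (xy_monom u - N :: 'a poly poly)" for u
  proof -
    obtain r s where u: "u = (r, s)" by (metis surj_pair)
    obtain v g where v: "v \<in> reduced_monoms q" "wdeg q v = wdeg q u"
        "reduced q g" "wdeg_below q (wdeg q v) g" "hermitian_poly q dvd (xy_monom u - (xy_monom v + g) :: 'a poly poly)"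
      using monom_reduction[OF q, of r s] unfolding u by blast
    show ?thesis
      by (intro exI[of _ "xy_monom v + g"] conjI reduced_add reduced_monom wdeg_below_add wdeg_below_monom wdeg_below_mono[OF v(4)] v)
         (simp_all add: v)
  qed
  then obtain N where N: "\<And>u. reduced q (N u)" "\<And>u. wdeg_below q (wdeg q u + 1) (N u)"
      "\<And>u. hermitian_poly q dvd (xy_monom u - N u :: 'a poly poly)"
    by metis
  define G where "G = (\<Sum>u\<in>xy_support F. scale_xy (xy_coeff F u) (N u))"
  have "reduced q G" unfolding G_def by (intro reduced_sum reduced_scale N)
  moreover have "wdeg_below q t G"
    unfolding G_def
  proof (intro wdeg_below_sum wdeg_below_scale)
    fix u assume "u \<in> xy_support F"
    then have "wdeg q u < t" using F unfolding wdeg_below_def xy_support_eq by blast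
    then show "wdeg_below q t (N u)" by (intro wdeg_below_mono[OF N(2)]) simp
  qed
  moreover have "F - G = (\<Sum>u\<in>xy_support F. scale_xy (xy_coeff F u) (xy_monom u - N u))"
    by (subst xy_expansion[of F]) (simp add: G_def sum_subtractf smult_diff_right)
  then have "hermitian_poly q dvd (F - G)"
    by (simp only:) (intro dvd_sum dvd_smult N)
  ultimately show ?thesis using that by blast
qed

lemma wmonic_reduction:
  fixes F :: "'a::comm_ring_1 poly poly"
  assumes q: "2 \<le> q" and F: "wmonic q u F"
  obtains v G where "v \<in> reduced_monoms q" "wdeg q v = wdeg q u" "reduced q G" "wmonic q v G"
    "hermitian_poly q dvd (F - G)"
proof -
  obtain r s where u: "u = (r, s)" by (metis surj_pair)
  obtain v g where v: "v \<in> reduced_monoms q" "wdeg q v = wdeg q u"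
      "reduced q g" "wdeg_below q (wdeg q v) g" "hermitian_poly q dvd (xy_monom u - (xy_monom v + g) :: 'a poly poly)"
    using monom_reduction[OF q, of r s] unfolding u by blast
  obtain h where h: "reduced q h" "wdeg_below q (wdeg q u) h" "hermitian_poly q dvd (F - xy_monom u - h)"
    using poly_reduction[OF q F[unfolded wmonic_def]] by blast
  show ?thesis
  proof (rule that[OF v(1,2)])
    show "reduced q (xy_monom v + g + h)" by (intro reduced_add reduced_monom v h)
    show "wmonic q v (xy_monom v + g + h)"
      unfolding wmonic_def using wdeg_below_add[OF v(4)] h(2) v(2) by (simp add: add.assoc)
    have "F - (xy_monom v + g + h) = (F - xy_monom u - h) + (xy_monom u - (xy_monom v + g))"
      by simp
    then show "hermitian_poly q dvd (F - (xy_monom v + g + h))"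
      by (simp only:) (intro dvd_add h v)
  qed
qed

section \<open>Leading weights and the initial ideal\<close>

definition leads :: "nat \<Rightarrow> ('a::comm_ring_1 \<times> 'a) set \<Rightarrow> nat \<times> nat \<Rightarrow> bool" where
  "leads q D u \<longleftrightarrow> (\<exists>F\<in>vanishing_ideal D. wmonic q u F)"

definition footprint :: "nat \<Rightarrow> ('a::comm_ring_1 \<times> 'a) set \<Rightarrow> (nat \<times> nat) set" where
  "footprint q D = {u \<in> reduced_monoms q. \<not> leads q D u}"

lemma vanishing_ideal_add: "F \<in> vanishing_ideal D \<Longrightarrow> G \<in> vanishing_ideal D \<Longrightarrow> F + G \<in> vanishing_ideal D"
  and vanishing_ideal_mult: "F \<in> vanishing_ideal D \<Longrightarrow> K * F \<in> vanishing_ideal D"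
  by (simp_all add: vanishing_ideal_def)

lemma vanishing_ideal_diff: "F \<in> vanishing_ideal D \<Longrightarrow> G \<in> vanishing_ideal D \<Longrightarrow> F - G \<in> vanishing_ideal D"
  and vanishing_ideal_scale: "F \<in> vanishing_ideal D \<Longrightarrow> scale_xy c F \<in> vanishing_ideal D"
  by (simp_all add: vanishing_ideal_def)

lemma hermitian_multiple_vanishes:
  "D \<subseteq> hermitian_points q \<Longrightarrow> hermitian_poly q dvd F \<Longrightarrow> F \<in> vanishing_ideal D"
  by (auto simp: vanishing_ideal_def hermitian_points_def elim!: dvdE)

text \<open>
  Multiplying by a monomial: the leading weights form an ideal of the weight semigroup.
\<close>
lemma leads_add: "leads q D u \<Longrightarrow> leads q D (u + v)"
  unfolding leads_def
  by (metis add.commute vanishing_ideal_mult wmonic_monom wmonic_mult)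

text \<open>
  $H$ vanishes on $D$, so reducing modulo $H$ does not leave the vanishing ideal.
\<close>
lemma leads_reduced_witness:
  fixes D :: "('a::comm_ring_1 \<times> 'a) set"
  assumes q: "2 \<le> q" and D: "D \<subseteq> hermitian_points q" and u: "leads q D u"
  obtains v G where "v \<in> reduced_monoms q" "wdeg q v = wdeg q u" "reduced q G" "wmonic q v G"
    "G \<in> vanishing_ideal D"
proof -
  obtain F where F: "F \<in> vanishing_ideal D" "wmonic q u F" using u by (auto simp: leads_def)
  obtain v G where G: "v \<in> reduced_monoms q" "wdeg q v = wdeg q u" "reduced q G" "wmonic q v G"
      "hermitian_poly q dvd (F - G)"
    using wmonic_reduction[OF q F(2)] by blast
  have "F - (F - G) \<in> vanishing_ideal D"
    by (intro vanishing_ideal_diff F hermitian_multiple_vanishes[OF D] G)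
  then show ?thesis using that G by simp
qed

text \<open>
  Two monomials of the same weight have the same reduced monomial as leading term modulo $H$. This
  lets shifts of monomials be replaced by sums of weights.
\<close>
lemma leads_cong:
  fixes D :: "('a::comm_ring_1 \<times> 'a) set"
  assumes q: "2 \<le> q" and D: "D \<subseteq> hermitian_points q" and u: "leads q D u" and uv: "wdeg q u = wdeg q v"
  shows "leads q D v"
proof -
  obtain u0 G where G: "u0 \<in> reduced_monoms q" "wdeg q u0 = wdeg q u" "reduced q G" "wmonic q u0 G"
    "G \<in> vanishing_ideal D" using leads_reduced_witness[OF q D u] by blast
  obtain v0 K where K: "v0 \<in> reduced_monoms q" "wdeg q v0 = wdeg q v" "reduced q K" "wmonic q v0 K"
    "hermitian_poly q dvd (xy_monom v - K :: 'a poly poly)" using wmonic_reduction[OF q wmonic_monom] by blast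
  have eq: "u0 = v0" using wdeg_inj_reduced[THEN inj_onD, of q u0 v0] G K uv by simp
  have "G + (xy_monom v - K) \<in> vanishing_ideal D"
    by (intro vanishing_ideal_add G hermitian_multiple_vanishes[OF D] K)
  moreover have "wdeg_below q (wdeg q v) ((G - xy_monom v0) - (K - xy_monom v0))"
    using wdeg_below_diff[OF G(4)[unfolded wmonic_def eq] K(4)[unfolded wmonic_def]] by (simp only: K(2))
  then have "wmonic q v (G + (xy_monom v - K))"
    by (simp add: wmonic_def algebra_simps)
  ultimately show ?thesis by (auto simp: leads_def)
qed

lemma wmonic_coeff: "wmonic q u F \<Longrightarrow> xy_coeff F u = 1"
  unfolding wmonic_def wdeg_below_def by (metis eq_iff_diff_eq_0 less_irrefl xy_coeff_diff xy_coeff_monom)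

lemma wmonic_support: "wmonic q u F \<Longrightarrow> v \<in> xy_support F \<Longrightarrow> v \<noteq> u \<Longrightarrow> wdeg q v < wdeg q u"
  unfolding wmonic_def wdeg_below_def xy_support_eq mem_Collect_eq
  by (metis diff_zero xy_coeff_diff xy_coeff_monom)

lemma wmonicI:
  assumes "xy_coeff F u = 1" "\<And>v. v \<in> xy_support F \<Longrightarrow> v \<noteq> u \<Longrightarrow> wdeg q v < wdeg q u"
  shows "wmonic q u F"
  unfolding wmonic_def wdeg_below_def 
proof (intro allI impI)
  fix v assume nz: "xy_coeff (F - xy_monom u) v \<noteq> 0"
  then have "v \<noteq> u" using assms(1) by (auto simp: xy_coeff_monom)
  with nz assms(2)[of v] show "wdeg q v < wdeg q u" by (auto simp: xy_support_eq xy_coeff_monom)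
qed

lemma is_LM_if_wmonic:
  assumes "u \<in> reduced_monoms q" "reduced q F" "wmonic q u F"
  shows "is_LM F u"
proof -
  have "xy_coeff F u \<noteq> 0" using wmonic_coeff[OF assms(3)]
    by (metis one_neq_zero)
  moreover have "drl_less v u" if "v \<in> xy_support F" "v \<noteq> u" for v
    using drl_less_iff_wdeg[of v q u] wmonic_support[OF assms(3) that] assms that by (auto simp: reduced_def)
  ultimately show ?thesis by (auto simp: is_LM_def xy_support_eq)
qed

lemma is_LM_imp_wmonic:
  fixes F :: "'a::field poly poly"
  assumes "is_LM F u" "u \<in> reduced_monoms q"
  shows "wmonic q u (scale_xy (inverse (xy_coeff F u)) F)" "xy_coeff F u \<noteq> 0"
proof -
  show nz: "xy_coeff F u \<noteq> 0" using assms(1) by (simp add: is_LM_def xy_support_eq)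
  show "wmonic q u (scale_xy (inverse (xy_coeff F u)) F)"
  proof (rule wmonicI)
    show "xy_coeff (scale_xy (inverse (xy_coeff F u)) F) u = 1" using nz by simp
    fix v assume "v \<in> xy_support (scale_xy (inverse (xy_coeff F u)) F)" "v \<noteq> u"
    then have "v \<in> xy_support F" "v \<noteq> u" by (auto simp: xy_support_eq)
    then have "drl_less v u" using assms(1) unfolding is_LM_def by blast
    then show "wdeg q v < wdeg q u" using drl_less_imp_wdeg_less assms(2) by blast
  qed
qed

text \<open>
  This is where weights meet DegRevLex: for reduced polynomials both orders select the same leading
  monomial, and a witness for either notion can be taken reduced or normalised.
\<close>
lemma leads_iff_LM:
  fixes D :: "('a::field \<times> 'a) set"
  assumes q: "2 \<le> q" and D: "D \<subseteq> hermitian_points q" and u: "u \<in> reduced_monoms q"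
  shows "(\<exists>F\<in>vanishing_ideal D. is_LM F u) \<longleftrightarrow> leads q D u"
proof
  assume "\<exists>F\<in>vanishing_ideal D. is_LM F u"
  then show "leads q D u" unfolding leads_def using is_LM_imp_wmonic(1)[OF _ u] vanishing_ideal_scale by blast
next
  assume "leads q D u"
  then obtain v G where G: "v \<in> reduced_monoms q" "wdeg q v = wdeg q u" "reduced q G" "wmonic q v G"
    "G \<in> vanishing_ideal D" using leads_reduced_witness[OF q D] by blast
  then have "v = u" using wdeg_inj_reduced[THEN inj_onD, of q v u] u by simp
  then show "\<exists>F\<in>vanishing_ideal D. is_LM F u" using is_LM_if_wmonic G by blast
qed

lemma drl_less_add: "drl_less (u + w) (v + w) \<longleftrightarrow> drl_less u v"
  by (cases u; cases v; cases w) (auto simp: drl_less_def)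

lemma xy_support_monom_mult: "xy_support (xy_monom v * F) = (\<lambda>u. u + v) ` xy_support F"
  for F :: "'a::comm_semiring_1 poly poly"
proof -
  obtain r s where v: "v = (r, s)" by (metis surj_pair)
  have "w \<in> xy_support (xy_monom v * F) \<longleftrightarrow> w \<in> (\<lambda>u. u + v) ` xy_support F" for w
  proof -
    obtain r' s' where w: "w = (r', s')" by (metis surj_pair)
    show ?thesis
    proof (cases "r \<le> r' \<and> s \<le> s'")
      case True
      have "w = u + v \<longleftrightarrow> u = (r' - r, s' - s)" for u using True by (cases u) (auto simp: v w)
      then show ?thesis using True by (auto simp: v w xy_coeff_monom_mult xy_support_eq)
    next
      case False
      then show ?thesis by (auto simp: v w xy_coeff_monom_mult xy_support_eq)
    qed
  qed
  then show ?thesis by blast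
qed

lemma is_LM_monom_mult: "is_LM F u \<Longrightarrow> is_LM (xy_monom v * F) (u + v)"
  for F :: "'a::comm_semiring_1 poly poly"
  by (auto simp: is_LM_def xy_support_monom_mult drl_less_add)

text \<open>
  The leading monomials of an ideal are closed under multiplication by monomials, so the polynomials
  supported on them already form an ideal, and a monomial of the initial ideal is one of them.
\<close>
lemma mem_initial_ideal:
  "xy_monom u \<in> initial_ideal (vanishing_ideal D) \<longleftrightarrow> (\<exists>F\<in>vanishing_ideal D. is_LM F u)"
  for D :: "('a::field \<times> 'a) set"
proof
  let ?S = "{xy_monom u |u. \<exists>F\<in>vanishing_ideal D. is_LM F u} :: 'a poly poly set"
  assume "\<exists>F\<in>vanishing_ideal D. is_LM F u"
  then show "xy_monom u \<in> initial_ideal (vanishing_ideal D)"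
    unfolding initial_ideal_def ideal_gen_def by (intro module.span_base[OF module_self]) blast
next
  let ?S = "{xy_monom u |u. \<exists>F\<in>vanishing_ideal D. is_LM F u} :: 'a poly poly set"
  assume "xy_monom u \<in> initial_ideal (vanishing_ideal D)"
  then have "xy_monom u \<in> module.span (*) ?S" by (simp add: initial_ideal_def ideal_gen_def)
  then have "xy_support (xy_monom u :: 'a poly poly) \<subseteq> {u. \<exists>F\<in>vanishing_ideal D. is_LM F u}"
  proof (induction rule: module.span_induct_alt[OF module_self, consumes 1, case_names base step])
    case base
    then show ?case by (simp add: xy_support_eq)
  next
    case (step c x y)
    then obtain v F where x: "x = xy_monom v" and F: "F \<in> vanishing_ideal D" "is_LM F v" by auto
    have "xy_support (c * x + y) \<subseteq> xy_support (c * x) \<union> xy_support y"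
      by (auto simp: xy_support_def)
    moreover have "xy_support (c * x) \<subseteq> {u. \<exists>F\<in>vanishing_ideal D. is_LM F u}"
    proof
      fix w assume "w \<in> xy_support (c * x)"
      then obtain w' where "w = v + w'" by (auto simp: x mult.commute[of c] xy_support_monom_mult add.commute)
      then show "w \<in> {u. \<exists>F\<in>vanishing_ideal D. is_LM F u}"
        using is_LM_monom_mult[OF F(2)] vanishing_ideal_mult[OF F(1)] by blast
    qed
    ultimately show ?case using step by blast
  qed
  moreover have "u \<in> xy_support (xy_monom u :: 'a poly poly)" by (simp add: xy_support_eq xy_coeff_monom)
  ultimately show "\<exists>F\<in>vanishing_ideal D. is_LM F u" by blast
qed

lemma is_LM_hermitian:
  assumes "2 \<le> q"
  shows "is_LM (hermitian_poly q :: 'a::field poly poly) (q + 1, 0)"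
proof -
  have "u = (q + 1, 0) \<or> u = (0, q) \<or> u = (0, 1)" if "u \<in> xy_support (hermitian_poly q :: 'a poly poly)" for u
    using that by (auto simp: xy_support_eq hermitian_poly_def xy_coeff_monom split: if_splits)
  moreover have "(q + 1, 0) \<in> xy_support (hermitian_poly q :: 'a poly poly)"
    by (simp add: xy_support_eq hermitian_poly_def xy_coeff_monom)
  moreover have "drl_less (0, q) (q + 1, 0)" "drl_less (0, 1) (q + 1, 0)"
    using assms by (auto simp: drl_less_def)
  ultimately show ?thesis unfolding is_LM_def by blast
qed

text \<open>
  A monomial divisible by $x^{q+1}$ is the leading monomial of a multiple of $H$ and therefore not
  standard; on the remaining ones \<open>leads_iff_LM\<close> applies.
\<close>
lemma standard_monoms_eq_footprint:
  fixes D :: "('a::field \<times> 'a) set"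
  assumes q: "2 \<le> q" and D: "D \<subseteq> hermitian_points q"
  shows "standard_monoms (initial_ideal (vanishing_ideal D)) = footprint q D"
proof -
  have "\<exists>F\<in>vanishing_ideal D. is_LM F u" if "u \<notin> reduced_monoms q" for u
  proof -
    obtain r s where u: "u = (r, s)" by (metis surj_pair)
    then have "u = (q + 1, 0) + (r - (q + 1), s)" using that by (auto simp: reduced_monoms_def)
    then show ?thesis using is_LM_monom_mult[OF is_LM_hermitian[OF q]]
        hermitian_multiple_vanishes[OF D dvd_triv_right] by metis
  qed
  then show ?thesis
    unfolding standard_monoms_def footprint_def mem_initial_ideal
    using leads_iff_LM[OF q D] by blast
qed

section \<open>Counting standard monomials by points\<close>

text \<open>
  Functions on $D$ are extended by zero to the whole plane, so that all of them live in one
  vector space of finite dimension whatever $D$ is.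
\<close>
definition eval_on :: "('a \<times> 'a) set \<Rightarrow> 'a poly poly \<Rightarrow> 'a::{field,finite} ^ ('a \<times> 'a)" where
  "eval_on D F = (\<chi> p. if p \<in> D then eval_xy F p else 0)"

definition eval_span :: "nat \<Rightarrow> ('a::{field,finite} \<times> 'a) set \<Rightarrow> nat \<Rightarrow> ('a ^ ('a \<times> 'a)) set" where
  "eval_span q D t = vec.span ((\<lambda>u. eval_on D (xy_monom u)) ` {u \<in> reduced_monoms q. wdeg q u < t})"

lemma eval_on_add: "eval_on D (F + G) = eval_on D F + eval_on D G"
  and eval_on_diff: "eval_on D (F - G) = eval_on D F - eval_on D G"
  and eval_on_scale: "eval_on D (scale_xy c F) = c *s eval_on D F"
  and eval_on_0: "eval_on D 0 = 0"
  by (simp_all add: eval_on_def vec_eq_iff)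

lemma eval_on_sum: "eval_on D (\<Sum>i\<in>A. f i) = (\<Sum>i\<in>A. eval_on D (f i))"
  by (induction A rule: infinite_finite_induct) (simp_all add: eval_on_0 eval_on_add)

lemma eval_on_eq_0_iff: "eval_on D F = 0 \<longleftrightarrow> F \<in> vanishing_ideal D"
  by (auto simp: eval_on_def vec_eq_iff vanishing_ideal_def)

lemma eval_span_mono: "t \<le> t' \<Longrightarrow> eval_span q D t \<subseteq> eval_span q D t'"
  unfolding eval_span_def by (intro vec.span_mono image_mono) auto

lemma eval_on_wdeg_below:
  assumes q: "2 \<le> q" and D: "D \<subseteq> hermitian_points q" and F: "wdeg_below q t F"
  shows "eval_on D F \<in> eval_span q D t"
proof -
  obtain G where G: "reduced q G" "wdeg_below q t G" "hermitian_poly q dvd (F - G)"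
    using poly_reduction[OF q F] by blast
  have "eval_on D (F - G) = 0" unfolding eval_on_eq_0_iff by (rule hermitian_multiple_vanishes[OF D G(3)])
  then have "eval_on D F = eval_on D G" by (simp add: eval_on_diff)
  also have "\<dots> = (\<Sum>u\<in>xy_support G. xy_coeff G u *s eval_on D (xy_monom u))"
    by (subst xy_expansion[of G]) (simp only: eval_on_sum eval_on_scale)
  also have "\<dots> \<in> eval_span q D t"
    unfolding eval_span_def
  proof (intro vec.span_sum vec.span_scale vec.span_base imageI CollectI conjI)
    fix u assume "u \<in> xy_support G"
    then show "u \<in> reduced_monoms q" "wdeg q u < t" using G(1,2)
      unfolding reduced_def wdeg_below_def xy_support_eq by blast+
  qed
  finally show ?thesis .
qed

lemma eval_span_witness:
  assumes "v \<in> eval_span q D t"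
  shows "\<exists>G. wdeg_below q t G \<and> eval_on D G = v"
  using assms unfolding eval_span_def
proof (induction rule: vec.span_induct_alt)
  case base
  then show ?case by (intro exI[of _ 0]) (simp add: eval_on_0)
next
  case (step c x y)
  then obtain u G where u: "wdeg q u < t" "x = eval_on D (xy_monom u)" and G: "wdeg_below q t G" "eval_on D G = y"
    by blast
  then show ?case
    by (intro exI[of _ "scale_xy c (xy_monom u) + G"])
       (auto intro!: wdeg_below_add wdeg_below_scale wdeg_below_monom simp: eval_on_add eval_on_scale)
qed

text \<open>
  The footprint consists of the monomials that a greedy selection by increasing weight keeps as a basis
  of the functions on $D$.
\<close>
lemma leads_iff_eval_on:
  assumes q: "2 \<le> q" and D: "D \<subseteq> hermitian_points q"
  shows "leads q D u \<longleftrightarrow> eval_on D (xy_monom u) \<in> eval_span q D (wdeg q u)"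
proof
  assume "leads q D u"
  then obtain F where F: "F \<in> vanishing_ideal D" "wmonic q u F" by (auto simp: leads_def)
  then have "eval_on D (F - xy_monom u) \<in> eval_span q D (wdeg q u)"
    unfolding wmonic_def by (intro eval_on_wdeg_below[OF q D])
  moreover have "eval_on D F = 0" using F by (simp add: eval_on_eq_0_iff)
  ultimately have "- eval_on D (xy_monom u) \<in> eval_span q D (wdeg q u)" by (simp add: eval_on_diff)
  then show "eval_on D (xy_monom u) \<in> eval_span q D (wdeg q u)"
    unfolding eval_span_def using vec.span_neg by fastforce
next
  assume "eval_on D (xy_monom u) \<in> eval_span q D (wdeg q u)"
  then obtain G where G: "wdeg_below q (wdeg q u) G" "eval_on D G = eval_on D (xy_monom u)" using eval_span_witness by blast
  have "xy_monom u - G \<in> vanishing_ideal D" using G(2) by (simp add: eval_on_diff flip: eval_on_eq_0_iff)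
  moreover have "wmonic q u (xy_monom u - G)"
    unfolding wmonic_def using wdeg_below_diff[OF wdeg_below_0 G(1)] by simp
  ultimately show "leads q D u" by (auto simp: leads_def)
qed

lemma reduced_monoms_less_Suc:
  obtains (new) u where "u \<in> reduced_monoms q" "wdeg q u = t"
      "{u \<in> reduced_monoms q. wdeg q u < Suc t} = insert u {u \<in> reduced_monoms q. wdeg q u < t}"
  | (none) "\<forall>u\<in>reduced_monoms q. wdeg q u \<noteq> t"
      "{u \<in> reduced_monoms q. wdeg q u < Suc t} = {u \<in> reduced_monoms q. wdeg q u < t}"
proof (cases "\<exists>u\<in>reduced_monoms q. wdeg q u = t")
  case True
  then obtain u where u: "u \<in> reduced_monoms q" "wdeg q u = t" by blast
  have "v = u" if "v \<in> reduced_monoms q" "wdeg q v = t" for v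
    using wdeg_inj_reduced[THEN inj_onD, of q v u] u that by simp
  then have "{u \<in> reduced_monoms q. wdeg q u < Suc t} = insert u {u \<in> reduced_monoms q. wdeg q u < t}"
    using u unfolding less_Suc_eq by blast
  then show ?thesis by (rule new[OF u])
next
  case False
  then show ?thesis by (intro none) (auto simp: less_Suc_eq)
qed

lemma finite_wdeg_less: "2 \<le> q \<Longrightarrow> finite {u. wdeg q u < t}"
proof (rule finite_subset)
  assume q: "2 \<le> q"
  show "{u. wdeg q u < t} \<subseteq> {..t} \<times> {..t}"
  proof clarsimp
    fix r s assume "wdeg q (r, s) < t"
    moreover have "r * 1 \<le> r * q" "s * 1 \<le> s * (q + 1)" using q by (intro mult_left_mono; simp)+
    ultimately show "r \<le> t \<and> s \<le> t" unfolding wdeg_def split_conv by linarith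
  qed
qed auto

text \<open>
  Raising the weight bound by one adds at most one reduced monomial, and the dimension grows exactly if
  that monomial is standard.
\<close>
lemma dim_eval_span:
  fixes D :: "('a::{field,finite} \<times> 'a) set"
  assumes q: "2 \<le> q" and D: "D \<subseteq> hermitian_points q"
  shows "vec.dim (eval_span q D t) = card {u \<in> footprint q D. wdeg q u < t}"
proof (induction t)
  case 0
  then show ?case by (simp add: eval_span_def)
next
  case (Suc t)
  show ?case
  proof (cases rule: reduced_monoms_less_Suc[of q t])
    case (new u)
    have d: "vec.dim (eval_span q D (Suc t)) =
        (if eval_on D (xy_monom u) \<in> eval_span q D t then vec.dim (eval_span q D t) else vec.dim (eval_span q D t) + 1)"
      unfolding eval_span_def new(3) image_insert vec.dim_span by (rule vec.dim_insert)
    have iff: "eval_on D (xy_monom u) \<in> eval_span q D t \<longleftrightarrow> u \<notin> footprint q D"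
      using leads_iff_eval_on[OF q D, of u] new by (simp add: footprint_def)
    have set: "{v \<in> footprint q D. wdeg q v < Suc t} =
        (if u \<in> footprint q D then insert u {v \<in> footprint q D. wdeg q v < t} else {v \<in> footprint q D. wdeg q v < t})"
      using new unfolding footprint_def by (auto simp: less_Suc_eq)
    have "finite {v \<in> footprint q D. wdeg q v < t}" by (rule finite_subset[OF _ finite_wdeg_less[OF q, of t]]) auto
    then show ?thesis using Suc new(2) unfolding d iff set by auto
  next
    case none
    have "{v \<in> footprint q D. wdeg q v < Suc t} = {v \<in> footprint q D. wdeg q v < t}"
      using none unfolding footprint_def by (auto simp: less_Suc_eq)
    then show ?thesis using Suc none(2) unfolding eval_span_def by simp
  qed
qed

text \<open>
  A product of lines, one through each other point and none through \<open>p\<close>.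
\<close>
lemma interpolation:
  fixes p :: "'a::{field,finite} \<times> 'a"
  shows "\<exists>F. \<forall>p'. (eval_xy F p' = 0) \<longleftrightarrow> p' \<noteq> p"
proof -
  let ?X = "xy_monom (1, 0) :: 'a poly poly" and ?Y = "xy_monom (0, 1) :: 'a poly poly"
  let ?one = "xy_monom (0, 0) :: 'a poly poly"
  define l where "l z = (if fst p = fst z then ?Y - scale_xy (snd z) ?one else ?X - scale_xy (fst z) ?one)" for z
  have vals: "eval_xy ?X z = fst z" "eval_xy ?Y z = snd z" "eval_xy ?one z = 1" for z
    by (cases z; simp add: eval_xy_monom)+
  have "eval_xy (l z) w = (if fst p = fst z then snd w - snd z else fst w - fst z)" for z w
    unfolding l_def by (simp add: vals[unfolded One_nat_def])
  then have l: "eval_xy (l z) z = 0" "z \<noteq> p \<Longrightarrow> eval_xy (l z) p \<noteq> 0" for z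
    by (auto simp: prod_eq_iff)
  show ?thesis
  proof (intro exI[of _ "\<Prod>p'\<in>UNIV - {p}. l p'"] allI)
    fix z
    have "(eval_xy (\<Prod>p'\<in>UNIV - {p}. l p') z = 0) \<longleftrightarrow> (\<exists>p'\<in>UNIV - {p}. eval_xy (l p') z = 0)"
      unfolding eval_xy_prod by (rule prod_zero_iff) simp
    then show "(eval_xy (\<Prod>p'\<in>UNIV - {p}. l p') z = 0) \<longleftrightarrow> z \<noteq> p"
      using l by blast
  qed
qed

lemma eval_on_mem_span_axis: "eval_on D F \<in> vec.span ((\<lambda>p. axis p 1) ` D)"
proof -
  have "eval_on D F = (\<Sum>p\<in>D. eval_xy F p *s axis p 1)"
    by (simp add: vec_eq_iff eval_on_def axis_def if_distrib[of "\<lambda>x. _ * x"] cong: if_cong)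
  also have "\<dots> \<in> vec.span ((\<lambda>p. axis p 1) ` D)"
    by (intro vec.span_sum vec.span_scale vec.span_base) auto
  finally show ?thesis .
qed

lemma eval_span_full:
  fixes D :: "('a::{field,finite} \<times> 'a) set"
  assumes q: "2 \<le> q" and D: "D \<subseteq> hermitian_points q"
  obtains T where "eval_span q D T = vec.span ((\<lambda>p. axis p 1) ` D)"
proof -
  have ex: "\<exists>F t. eval_on D F = axis p 1 \<and> wdeg_below q t F" if "p \<in> D" for p
  proof -
    obtain F where F: "\<forall>p'. (eval_xy F p' = 0) \<longleftrightarrow> p' \<noteq> p" using interpolation by blast
    have "eval_on D (scale_xy (inverse (eval_xy F p)) F) = axis p 1"
      using F that by (auto simp: vec_eq_iff eval_on_def axis_def)
    then show ?thesis using ex_wdeg_below by blast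
  qed
  then obtain F t where Ft: "\<And>p. p \<in> D \<Longrightarrow> eval_on D (F p) = axis p 1" "\<And>p. p \<in> D \<Longrightarrow> wdeg_below q (t p) (F p)"
    by metis
  define T where "T = Max (t ` D)"
  have "axis p 1 \<in> eval_span q D T" if "p \<in> D" for p
  proof -
    have "t p \<le> T" unfolding T_def using that by (intro Max_ge) auto
    then show ?thesis using eval_on_wdeg_below[OF q D Ft(2)[OF that]] Ft(1)[OF that] eval_span_mono by fastforce
  qed
  then have "vec.span ((\<lambda>p. axis p 1) ` D) \<subseteq> eval_span q D T"
    unfolding eval_span_def by (intro vec.span_minimal) auto
  moreover have "eval_span q D T \<subseteq> vec.span ((\<lambda>p. axis p 1) ` D)"
    unfolding eval_span_def using eval_on_mem_span_axis by (intro vec.span_minimal) auto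
  ultimately show ?thesis using that by blast
qed

lemma footprint_bounded:
  fixes D :: "('a::{field,finite} \<times> 'a) set"
  assumes q: "2 \<le> q" and D: "D \<subseteq> hermitian_points q"
    and T: "eval_span q D T = vec.span ((\<lambda>p. axis p 1) ` D)" and u: "u \<in> footprint q D"
  shows "wdeg q u < T"
proof (rule ccontr)
  assume n: "\<not> wdeg q u < T"
  have "eval_on D (xy_monom u) \<in> eval_span q D T" unfolding T by (rule eval_on_mem_span_axis)
  then have "eval_on D (xy_monom u) \<in> eval_span q D (wdeg q u)" using eval_span_mono n by (meson not_less subsetD)
  then show False using u leads_iff_eval_on[OF q D] by (simp add: footprint_def)
qed

text \<open>
  For a large weight bound the monomials span all functions on $D$, a space of dimension $|D|$.
\<close>
lemma card_footprint:
  fixes D :: "('a::{field,finite} \<times> 'a) set"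
  assumes q: "2 \<le> q" and D: "D \<subseteq> hermitian_points q"
  shows "finite (footprint q D)" "card (footprint q D) = card D"
proof -
  obtain T where T: "eval_span q D T = vec.span ((\<lambda>p. axis p 1) ` D)" using eval_span_full[OF q D] by blast
  have eq: "{u \<in> footprint q D. wdeg q u < T} = footprint q D" using footprint_bounded[OF q D T] by blast
  then show "finite (footprint q D)" using finite_subset[OF _ finite_wdeg_less[OF q, of T]] by blast
  have ind: "vec.independent ((\<lambda>p. axis p 1 :: 'a ^ ('a \<times> 'a)) ` D)"
    by (rule vec.independent_mono[OF independent_cart_basis]) (auto simp: cart_basis_def)
  have "card (footprint q D) = vec.dim (vec.span ((\<lambda>p. axis p 1 :: 'a ^ ('a \<times> 'a)) ` D))"
    using dim_eval_span[OF q D, of T] eq T by simp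
  also have "\<dots> = card ((\<lambda>p. axis p 1 :: 'a ^ ('a \<times> 'a)) ` D)"
    by (rule vec.dim_span_eq_card_independent[OF ind])
  also have "\<dots> = card D" by (intro card_image inj_onI) (auto simp: axis_eq_axis)
  finally show "card (footprint q D) = card D" .
qed

text \<open>
  Monomials outside the footprint add nothing to the span, so otherwise the monomials of weight at
  most \<open>m\<close> would span every function on $D$, among them the indicator of \<open>p\<close>, on which the
  functional has the nonzero value \<open>c p\<close>.
\<close>
lemma footprint_beyond_if_orthogonal:
  fixes D :: "('a::{field,finite} \<times> 'a) set"
  assumes q: "2 \<le> q" and D: "D \<subseteq> hermitian_points q"
    and orth: "\<And>u. u \<in> reduced_monoms q \<Longrightarrow> wdeg q u \<le> m \<Longrightarrow> (\<Sum>p\<in>D. c p * eval_xy (xy_monom u) p) = 0"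
    and p: "p \<in> D" "c p \<noteq> 0"
  shows "\<exists>u\<in>footprint q D. m < wdeg q u"
proof (rule ccontr)
  assume "\<not> ?thesis"
  then have le: "wdeg q u \<le> m" if "u \<in> footprint q D" for u using that by (meson not_less)
  have sub: "eval_span q D t \<subseteq> eval_span q D (Suc m)" for t
  proof (induction t)
    case 0
    then show ?case by (simp add: eval_span_mono)
  next
    case (Suc t)
    show ?case
    proof (cases "t \<le> m")
      case True
      then show ?thesis by (intro eval_span_mono) simp
    next
      case False
      show ?thesis
      proof (cases rule: reduced_monoms_less_Suc[of q t])
        case (new u)
        then have "u \<notin> footprint q D" using le[of u] False by auto
        then have "eval_on D (xy_monom u) \<in> eval_span q D t"
          using new leads_iff_eval_on[OF q D, of u] by (simp add: footprint_def)
        then have "eval_span q D (Suc t) = eval_span q D t"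
          unfolding eval_span_def new(3) image_insert by (intro vec.span_redundant)
        then show ?thesis using Suc by simp
      next
        case none
        then show ?thesis using Suc by (simp add: eval_span_def)
      qed
    qed
  qed
  obtain T where T: "eval_span q D T = vec.span ((\<lambda>p. axis p 1) ` D)" using eval_span_full[OF q D] by blast
  have "axis p 1 \<in> eval_span q D T" unfolding T using p by (intro vec.span_base) auto
  then have "axis p 1 \<in> eval_span q D (Suc m)" using sub by blast
  then have "(\<Sum>x\<in>D. c x * axis p 1 $ x) = 0"
    unfolding eval_span_def
  proof (induction rule: vec.span_induct_alt)
    case base
    then show ?case by simp
  next
    case (step a x y)
    then obtain u where u: "u \<in> reduced_monoms q" "wdeg q u \<le> m" "x = eval_on D (xy_monom u)" by auto
    have "(\<Sum>z\<in>D. c z * x $ z) = (\<Sum>p\<in>D. c p * eval_xy (xy_monom u) p)"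
      unfolding u by (rule sum.cong) (auto simp: eval_on_def)
    also have "\<dots> = 0" by (rule orth[OF u(1,2)])
    finally have "(\<Sum>z\<in>D. c z * x $ z) = 0" .
    moreover have "(\<Sum>z\<in>D. c z * (a *s x + y) $ z) = a * (\<Sum>z\<in>D. c z * x $ z) + (\<Sum>z\<in>D. c z * y $ z)"
      by (simp add: sum.distrib sum_distrib_left algebra_simps)
    ultimately show ?case using step by simp
  qed
  moreover have "(\<Sum>x\<in>D. c x * axis p 1 $ x) = c p"
    using p by (simp add: axis_def if_distrib[of "\<lambda>x. _ * x"] sum.delta cong: if_cong)
  ultimately show False using p by simp
qed

text \<open>
  A standard monomial is independent of all lighter ones, so a linear map can kill these and
  keep it; reading off a coordinate where the image is nonzero gives the functional.
\<close>
lemma separating_functional: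
  fixes D :: "('a::{field,finite} \<times> 'a) set"
  assumes q: "2 \<le> q" and D: "D \<subseteq> hermitian_points q" and u: "u \<in> footprint q D"
  obtains c where "\<And>v. v \<in> reduced_monoms q \<Longrightarrow> wdeg q v < wdeg q u \<Longrightarrow> (\<Sum>p\<in>D. c p * eval_xy (xy_monom v) p) = 0"
    "(\<Sum>p\<in>D. c p * eval_xy (xy_monom u) p) \<noteq> 0"
proof -
  let ?e = "eval_on D (xy_monom u)"
  have notin: "?e \<notin> eval_span q D (wdeg q u)" using u leads_iff_eval_on[OF q D] by (simp add: footprint_def)
  obtain B where B: "B \<subseteq> eval_span q D (wdeg q u)" "vec.independent B" "eval_span q D (wdeg q u) \<subseteq> vec.span B"
    using vec.maximal_independent_subset by blast
  have "vec.span B \<subseteq> eval_span q D (wdeg q u)" using B(1) unfolding eval_span_def by (intro vec.span_minimal vec.subspace_span)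
  then have "?e \<notin> vec.span B" using notin by blast
  then have "vec.independent (insert ?e B)" using B(2) by (rule vec.independent_insertI)
  from vec.linear_independent_extend[OF this, of "\<lambda>x. if x = ?e then ?e else 0"]
  obtain g :: "'a ^ ('a \<times> 'a) \<Rightarrow> 'a ^ ('a \<times> 'a)" where g: "Vector_Spaces.linear (*s) (*s) g" "\<forall>x\<in>insert ?e B. g x = (if x = ?e then ?e else 0)"
    by blast
  interpret g: Vector_Spaces.linear "(*s)" "(*s)" g by fact
  have "0 \<in> eval_span q D (wdeg q u)" unfolding eval_span_def by (rule vec.span_zero)
  then have "?e \<noteq> 0" using notin by auto
  then obtain z where z: "?e $ z \<noteq> 0" by (auto simp: vec_eq_iff)
  have eB: "?e \<notin> B" using \<open>?e \<notin> vec.span B\<close> vec.span_base by blast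
  have "g x = 0" if "x \<in> vec.span B" for x
    by (rule g.eq_0_on_span[OF _ that]) (use g(2) eB in auto)
  then have g0: "g x = 0" if "x \<in> eval_span q D (wdeg q u)" for x using B(3) that by blast
  define c where "c p = g (axis p 1) $ z" for p
  have sum: "(\<Sum>p\<in>D. c p * eval_xy F p) = g (eval_on D F) $ z" for F
  proof -
    have "g (eval_on D F) $ z = (\<Sum>p\<in>UNIV. (eval_on D F $ p) * g (axis p 1) $ z)"
      by (rule linear_componentwise[OF g(1)])
    also have "\<dots> = (\<Sum>p\<in>D. (eval_on D F $ p) * g (axis p 1) $ z)"
      by (rule sum.mono_neutral_right) (auto simp: eval_on_def)
    also have "\<dots> = (\<Sum>p\<in>D. c p * eval_xy F p)" by (rule sum.cong) (auto simp: eval_on_def c_def)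
    finally show ?thesis by simp
  qed
  show ?thesis
  proof (rule that[of c])
    show "(\<Sum>p\<in>D. c p * eval_xy (xy_monom u) p) \<noteq> 0" unfolding sum using g(2) z by simp
    fix v assume "v \<in> reduced_monoms q" "wdeg q v < wdeg q u"
    then have "eval_on D (xy_monom v) \<in> eval_span q D (wdeg q u)"
      unfolding eval_span_def by (intro vec.span_base) auto
    then show "(\<Sum>p\<in>D. c p * eval_xy (xy_monom v) p) = 0" unfolding sum by (simp add: g0)
  qed
qed

section \<open>Staircases in the weight semigroup\<close>

text \<open>
  The reduced monomials whose weight is not that of a multiple of $x^\<mu> y^l$, for $\<mu> \<le> q$.
  Columns with $r < \<mu>$ are higher by $q$, since $x^{q+1}$ can be traded for $y^q$:
  $x^r y^{l+q}$ has the weight of $x^{r+q+1} y^l$.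
\<close>
definition staircase :: "nat \<Rightarrow> nat \<times> nat \<Rightarrow> (nat \<times> nat) set" where
  "staircase q = (\<lambda>(\<mu>, l). {(r, s). r \<le> q \<and> s < (if r < \<mu> then l + q else l)})"

text \<open>
  The monomial whose weight is smaller than that of $x^a y^b$ by $q^2-q-1$, the largest gap of the weight
  semigroup. The second component is truncated when there is no such monomial.
\<close>
definition corner :: "nat \<Rightarrow> nat \<times> nat \<Rightarrow> nat \<times> nat" where
  "corner q = (\<lambda>(a, b). if a < q then (a + 1, b + 1 - q) else (0, b + 1))"

lemma card_staircase:
  assumes "\<mu> \<le> q"
  shows "finite (staircase q (\<mu>, l))" "card (staircase q (\<mu>, l)) = wdeg q (\<mu>, l)"
proof -
  have eq: "staircase q (\<mu>, l) = (SIGMA r:{..q}. {..<l + (if r < \<mu> then q else 0)})"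
    by (auto simp: staircase_def split: if_splits)
  show "finite (staircase q (\<mu>, l))" unfolding eq by auto
  have "card (staircase q (\<mu>, l)) = (\<Sum>r\<in>{..q}. l + (if r < \<mu> then q else 0))"
    unfolding eq by (subst card_SigmaI) auto
  also have "\<dots> = (q + 1) * l + (\<Sum>r\<in>{..q}. if r < \<mu> then q else 0)"
    by (simp add: sum.distrib)
  also have "(\<Sum>r\<in>{..q}. if r < \<mu> then q else 0) = (\<Sum>r\<in>{..<\<mu>}. q)"
    using assms by (intro sum.mono_neutral_cong_right) auto
  finally show "card (staircase q (\<mu>, l)) = wdeg q (\<mu>, l)" by (simp add: wdeg_def algebra_simps)
qed

lemma staircase_subset_reduced: "staircase q u \<subseteq> reduced_monoms q"
  by (cases u) (auto simp: staircase_def reduced_monoms_def)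

lemma wdeg_shift: "wdeg q (r + (q + 1), s) = wdeg q (r, s + q)"
  by (simp add: wdeg_def algebra_simps)

lemma multiple_if_not_in_staircase:
  assumes "\<mu> \<le> q" "u \<in> reduced_monoms q" "u \<notin> staircase q (\<mu>, l)"
  obtains w where "wdeg q u = wdeg q ((\<mu>, l) + w)"
proof -
  obtain r s where u: "u = (r, s)" by (metis surj_pair)
  with assms have r: "r \<le> q" and s: "s \<ge> (if r < \<mu> then l + q else l)"
    by (auto simp: reduced_monoms_def staircase_def)
  show ?thesis
  proof (cases "r < \<mu>")
    case True
    have "wdeg q u = wdeg q (r + (q + 1), s - q)"
      using s True by (simp only: u wdeg_shift) simp
    also have "(r + (q + 1), s - q) = (\<mu>, l) + (r + (q + 1) - \<mu>, s - q - l)"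
      using s True assms(1) by auto
    finally show ?thesis by (rule that)
  next
    case False
    then have "u = (\<mu>, l) + (r - \<mu>, s - l)" using s by (auto simp: u)
    then show ?thesis using that by metis
  qed
qed

text \<open>
  The reduced monomial with the weight of a multiple of $x^\<mu> y^l$ is obtained by adding exponents
  and, if the exponent of $x$ exceeds $q$, trading $x^{q+1}$ for $y^q$ once. Either way it ends up outside
  the staircase.
\<close>
lemma not_multiple_if_in_staircase:
  assumes "\<mu> \<le> q" "u \<in> staircase q (\<mu>, l)" "w \<in> reduced_monoms q"
  shows "wdeg q u \<noteq> wdeg q ((\<mu>, l) + w)"
proof
  assume eq: "wdeg q u = wdeg q ((\<mu>, l) + w)"
  obtain r' s' where w: "w = (r', s')" by (metis surj_pair)
  have r': "r' \<le> q" using assms(3) by (simp add: w reduced_monoms_def)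
  have u: "u \<in> reduced_monoms q" using assms(2) staircase_subset_reduced by blast
  show False
  proof (cases "\<mu> + r' \<le> q")
    case True
    then have "u = (\<mu> + r', l + s')"
      using wdeg_inj_reduced[THEN inj_onD, of q u "(\<mu> + r', l + s')"] eq u by (simp add: w reduced_monoms_def)
    then show False using assms(2) by (simp add: staircase_def)
  next
    case False
    then have "(\<mu>, l) + w = (\<mu> + r' - (q + 1) + (q + 1), l + s')" by (simp add: w)
    then have "wdeg q u = wdeg q (\<mu> + r' - (q + 1), l + s' + q)" using eq wdeg_shift by metis
    then have "u = (\<mu> + r' - (q + 1), l + s' + q)"
      using wdeg_inj_reduced[THEN inj_onD, of q u "(\<mu> + r' - (q + 1), l + s' + q)"] u r' assms(1)
      by (simp add: reduced_monoms_def)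
    then show False using assms(2) r' False by (auto simp: staircase_def split: if_splits)
  qed
qed

text \<open>
  The bound on the weight excludes precisely the truncated case: if $a < q$ and $b \<le> q-2$, the weight
  is at most $(q-1)q + (q-2)(q+1) = 2q^2-2q-2$.
\<close>
lemma wdeg_corner:
  assumes q: "2 \<le> q" and u: "u \<in> reduced_monoms q" and large: "2 * q^2 - 2 * q - 2 < wdeg q u"
  shows "wdeg q (corner q u) + (q^2 - q - 1) = wdeg q u" "fst (corner q u) \<le> q"
    and "fst u < q \<Longrightarrow> q \<le> snd u + 1"
proof -
  obtain a b where ab: "u = (a, b)" by (metis surj_pair)
  have a: "a \<le> q" using u by (simp add: ab reduced_monoms_def)
  obtain k where k: "q = k + 2" using q by (metis add.commute le_Suc_ex)
  have qq: "q^2 - q - 1 = k * k + 3 * k + 1" by (simp add: k power2_eq_square algebra_simps)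
  show b: "q \<le> snd u + 1" if lt: "fst u < q"
  proof (rule ccontr)
    assume "\<not> q \<le> snd u + 1"
    then have "b \<le> k" "a \<le> k + 1" using lt by (auto simp: ab k)
    then have "a * q \<le> (k + 1) * q" "b * (q + 1) \<le> k * (q + 1)" by (intro mult_right_mono; simp)+
    then have "wdeg q u \<le> (k + 1) * q + k * (q + 1)" by (simp add: ab wdeg_def)
    also have "\<dots> = 2 * q^2 - 2 * q - 2" by (simp add: k power2_eq_square algebra_simps)
    finally show False using large by simp
  qed
  show "fst (corner q u) \<le> q" by (simp add: corner_def ab)
  show "wdeg q (corner q u) + (q^2 - q - 1) = wdeg q u"
  proof (cases "a < q")
    case True
    then obtain j where j: "b + 1 = q + j" using b by (metis ab fst_conv snd_conv le_Suc_ex)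
    then have b': "b = j + k + 1" by (simp add: k)
    show ?thesis using True unfolding qq by (simp add: corner_def ab j wdeg_def) (simp add: b' k algebra_simps)
  next
    case False
    then have "a = q" using a by simp
    then show ?thesis unfolding qq by (simp add: corner_def ab wdeg_def) (simp add: k algebra_simps)
  qed
qed

lemma mem_staircase_corner: "u \<in> reduced_monoms q \<Longrightarrow> u \<in> staircase q (corner q u)"
  by (cases u) (auto simp: staircase_def corner_def reduced_monoms_def)

text \<open>
  The symmetry of the semigroup in explicit form: for columns $r \<le> a$ complement inside the
  rectangle below $x^a y^b$, for the others write the weight of $x^a y^b$ as that of
  $x^{a+q+1} y^{b-q}$ first.
\<close>
lemma complement_in_staircase_corner:
  assumes q: "2 \<le> q" and u: "u \<in> reduced_monoms q" and large: "2 * q^2 - 2 * q - 2 < wdeg q u"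
    and v: "v \<in> staircase q (corner q u)"
  obtains w where "wdeg q (v + w) = wdeg q u"
proof -
  obtain a b r s where ab: "u = (a, b)" and rs: "v = (r, s)" by (metis surj_pair)
  have a: "a \<le> q" using u by (simp add: ab reduced_monoms_def)
  note b = wdeg_corner(3)[OF q u large]
  show ?thesis
  proof (cases "r \<le> a")
    case True
    then have "s \<le> b" using v a b by (auto simp: staircase_def corner_def ab rs split: if_splits)
    then have "v + (a - r, b - s) = u" using True by (simp add: ab rs)
    then show ?thesis using that by metis
  next
    case False
    then have r: "r \<le> q" "a < q" and s: "s + q \<le> b"
      using v a b by (auto simp: staircase_def corner_def ab rs split: if_splits)
    have "v + (a + (q + 1) - r, b - q - s) = (a + (q + 1), b - q)" using r s False by (simp add: rs)
    moreover have "wdeg q (a + (q + 1), b - q) = wdeg q u" unfolding wdeg_shift using s by (simp add: ab)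
    ultimately show ?thesis using that by metis
  qed
qed

section \<open>Footprints of extremal size\<close>

lemma footprint_subset_staircase:
  fixes D :: "('a::comm_ring_1 \<times> 'a) set"
  assumes q: "2 \<le> q" and D: "D \<subseteq> hermitian_points q" and \<mu>: "\<mu> \<le> q" and lead: "leads q D (\<mu>, l)"
  shows "footprint q D \<subseteq> staircase q (\<mu>, l)"
proof
  fix u assume u: "u \<in> footprint q D"
  show "u \<in> staircase q (\<mu>, l)"
  proof (rule ccontr)
    assume "u \<notin> staircase q (\<mu>, l)"
    then obtain w where w: "wdeg q u = wdeg q ((\<mu>, l) + w)"
      using multiple_if_not_in_staircase[OF \<mu>, of u l] u by (auto simp: footprint_def)
    have "leads q D u" by (rule leads_cong[OF q D leads_add[OF lead] w[symmetric]])
    then show False using u by (simp add: footprint_def)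
  qed
qed

text \<open>
  If $x^r y^s$ were a leading monomial, so would be all monomials of weight \<open>wdeg q u\<close>, because that
  weight is obtained from it by adding a semigroup element.
\<close>
lemma staircase_subset_footprint:
  fixes D :: "('a::comm_ring_1 \<times> 'a) set"
  assumes q: "2 \<le> q" and D: "D \<subseteq> hermitian_points q"
    and u: "u \<in> footprint q D" and large: "2 * q^2 - 2 * q - 2 < wdeg q u"
  shows "staircase q (corner q u) \<subseteq> footprint q D"
proof
  fix v assume v: "v \<in> staircase q (corner q u)"
  have u': "u \<in> reduced_monoms q" using u by (simp add: footprint_def)
  obtain w where w: "wdeg q (v + w) = wdeg q u" using complement_in_staircase_corner[OF q u' large v] .
  have "\<not> leads q D v"
    using leads_cong[OF q D leads_add w] u by (auto simp: footprint_def)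
  moreover have "v \<in> reduced_monoms q" using v staircase_subset_reduced by blast
  ultimately show "v \<in> footprint q D" by (simp add: footprint_def)
qed

lemma card_staircase_corner:
  assumes q: "2 \<le> q" and u: "u \<in> reduced_monoms q" and large: "2 * q^2 - 2 * q - 2 < wdeg q u"
  shows "finite (staircase q (corner q u))" "card (staircase q (corner q u)) + (q^2 - q - 1) = wdeg q u"
proof -
  obtain \<mu> l where c: "corner q u = (\<mu>, l)" by (metis surj_pair)
  have "\<mu> \<le> q" using wdeg_corner(2)[OF q u large] by (simp add: c)
  then show "finite (staircase q (corner q u))" "card (staircase q (corner q u)) + (q^2 - q - 1) = wdeg q u"
    using card_staircase[of \<mu> q l] wdeg_corner(1)[OF q u large] by (simp_all add: c)
qed

lemma wdeg_footprint_bound: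
  fixes D :: "('a::{field,finite} \<times> 'a) set"
  assumes q: "2 \<le> q" and D: "D \<subseteq> hermitian_points q"
    and u: "u \<in> footprint q D" and large: "2 * q^2 - 2 * q - 2 < wdeg q u"
  shows "wdeg q u \<le> card D + (q^2 - q - 1)"
proof -
  have u': "u \<in> reduced_monoms q" using u by (simp add: footprint_def)
  have "card (staircase q (corner q u)) \<le> card D"
    using card_mono[OF card_footprint(1)[OF q D] staircase_subset_footprint[OF q D u large]] card_footprint(2)[OF q D] by simp
  then show ?thesis using card_staircase_corner(2)[OF q u' large] by simp
qed

text \<open>
  The size of $D$ leaves room for the staircase of \<open>u0\<close> only. A standard monomial of weight beyond
  \<open>m\<close> must therefore have weight exactly $m+1$, and its staircase fills the footprint.
\<close>
lemma footprint_of_extremal_support: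
  fixes D :: "('a::{field,finite} \<times> 'a) set"
  assumes q: "2 \<le> q" and D: "D \<subseteq> hermitian_points q" and m: "2 * q^2 - 2 * q - 2 \<le> m"
    and u0: "u0 \<in> reduced_monoms q" "wdeg q u0 = m + 1"
    and card: "card D = wdeg q (corner q u0)"
    and ex: "\<exists>u\<in>footprint q D. m < wdeg q u"
  shows "footprint q D = staircase q (corner q u0)" "{u \<in> footprint q D. m < wdeg q u} = {u0}"
proof -
  have large: "2 * q^2 - 2 * q - 2 < wdeg q u0" using m u0 by simp
  have eq: "u = u0" if u: "u \<in> footprint q D" "m < wdeg q u" for u
  proof -
    have "wdeg q u \<le> card D + (q^2 - q - 1)" using wdeg_footprint_bound[OF q D u(1)] u(2) m by simp
    also have "\<dots> = m + 1" using wdeg_corner(1)[OF q u0(1) large] u0(2) card by simp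
    finally have "wdeg q u = wdeg q u0" using u u0 by simp
    then show ?thesis using wdeg_inj_reduced[THEN inj_onD, of q u u0] u u0 by (simp add: footprint_def)
  qed
  with ex have u0f: "u0 \<in> footprint q D" by blast
  moreover have "m < wdeg q u0" using u0 by simp
  ultimately show "{u \<in> footprint q D. m < wdeg q u} = {u0}" using eq by blast
  have sub: "staircase q (corner q u0) \<subseteq> footprint q D"
    by (rule staircase_subset_footprint[OF q D u0f large])
  have "card (staircase q (corner q u0)) = card (footprint q D)"
    using card_staircase_corner(2)[OF q u0(1) large] wdeg_corner(1)[OF q u0(1) large] card card_footprint(2)[OF q D]
    by simp
  then show "footprint q D = staircase q (corner q u0)"
    using card_subset_eq[OF card_footprint(1)[OF q D] sub] by simp
qed

text \<open>
  The functional that separates \<open>u0\<close> from the lighter monomials could vanish at some points of $D$. Its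
  support is however large by the same bound, \<open>wdeg_footprint_bound\<close>, which leaves no room
  for zeros.
\<close>
lemma full_support_functional:
  fixes D :: "('a::{field,finite} \<times> 'a) set"
  assumes q: "2 \<le> q" and D: "D \<subseteq> hermitian_points q" and m: "2 * q^2 - 2 * q - 2 \<le> m"
    and u0: "u0 \<in> footprint q D" "wdeg q u0 = m + 1"
    and card: "card D = wdeg q (corner q u0)"
  obtains c where "\<And>p. p \<in> D \<Longrightarrow> c p \<noteq> 0"
    "\<And>u. u \<in> reduced_monoms q \<Longrightarrow> wdeg q u \<le> m \<Longrightarrow> (\<Sum>p\<in>D. c p * eval_xy (xy_monom u) p) = 0"
proof -
  obtain c where c: "\<And>v. v \<in> reduced_monoms q \<Longrightarrow> wdeg q v < wdeg q u0 \<Longrightarrow> (\<Sum>p\<in>D. c p * eval_xy (xy_monom v) p) = 0"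
    "(\<Sum>p\<in>D. c p * eval_xy (xy_monom u0) p) \<noteq> 0"
    using separating_functional[OF q D u0(1)] by blast
  define D' where "D' = {p \<in> D. c p \<noteq> 0}"
  have D': "D' \<subseteq> D" "D' \<subseteq> hermitian_points q" using D by (auto simp: D'_def)
  have sum: "(\<Sum>p\<in>D'. c p * eval_xy F p) = (\<Sum>p\<in>D. c p * eval_xy F p)" for F
    by (rule sum.mono_neutral_left) (auto simp: D'_def)
  have "\<exists>p. p \<in> D' \<and> c p \<noteq> 0"
  proof (rule ccontr)
    assume "\<nexists>p. p \<in> D' \<and> c p \<noteq> 0"
    then have "D' = {}" by (auto simp: D'_def)
    then show False using c(2) by (simp flip: sum)
  qed
  then obtain p where p: "p \<in> D'" "c p \<noteq> 0" by blast
  have orth: "(\<Sum>p\<in>D'. c p * eval_xy (xy_monom u) p) = 0" if "u \<in> reduced_monoms q" "wdeg q u \<le> m" for u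
    unfolding sum using c(1) that u0(2) by simp
  obtain u where u: "u \<in> footprint q D'" "m < wdeg q u"
    using footprint_beyond_if_orthogonal[where c = c, OF q D'(2) orth p] by blast
  have "m + 1 \<le> card D' + (q^2 - q - 1)" using wdeg_footprint_bound[OF q D'(2) u(1)] u(2) m by simp
  moreover have "card D + (q^2 - q - 1) = m + 1"
    using wdeg_corner(1)[OF q, of u0] u0 m card by (simp add: footprint_def)
  ultimately have "D' = D" using card_seteq[OF _ D'(1)] by simp
  then have nz: "c p \<noteq> 0" if "p \<in> D" for p using that by (auto simp: D'_def)
  show ?thesis by (rule that[of c, OF nz c(1)]) (simp_all add: u0(2))
qed

section \<open>Complete intersections with the curve\<close>

lemma ideal_gen_add: "f \<in> ideal_gen S \<Longrightarrow> g \<in> ideal_gen S \<Longrightarrow> f + g \<in> ideal_gen S"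
  unfolding ideal_gen_def by (rule module.span_add[OF module_self])

lemma ideal_gen_diff: "f \<in> ideal_gen S \<Longrightarrow> g \<in> ideal_gen S \<Longrightarrow> f - g \<in> ideal_gen S"
  unfolding ideal_gen_def by (rule module.span_diff[OF module_self])

lemma ideal_gen_mult: "f \<in> ideal_gen S \<Longrightarrow> c * f \<in> ideal_gen S"
  unfolding ideal_gen_def by (rule module.span_scale[OF module_self])

lemma ideal_gen_base: "f \<in> S \<Longrightarrow> f \<in> ideal_gen S"
  unfolding ideal_gen_def by (rule module.span_base[OF module_self])

lemma ideal_gen_scale: "f \<in> ideal_gen S \<Longrightarrow> scale_xy c f \<in> ideal_gen S"
  using ideal_gen_mult[of f S "[:[:c:]:]"] by simp

lemma ideal_gen_dvd: "H \<in> S \<Longrightarrow> H dvd f \<Longrightarrow> f \<in> ideal_gen S"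
  by (metis dvdE ideal_gen_base ideal_gen_mult mult.commute)

lemma scale_xy_inverse:
  fixes F :: "'a::field poly poly"
  assumes "c \<noteq> 0"
  shows "scale_xy c (scale_xy (inverse c) F) = F" "scale_xy (inverse c) (scale_xy c F) = F"
  using assms by (auto intro!: xy_coeff_eqI simp del: smult_smult)

lemma reduced_normalize:
  fixes K :: "'a::field poly poly"
  assumes K: "reduced q K" "K \<noteq> 0"
  obtains c u K' where "c \<noteq> 0" "u \<in> reduced_monoms q" "u \<in> xy_support K" "wmonic q u K'" "K = scale_xy c K'"
proof -
  have "xy_support K \<noteq> {}" using K(2) xy_coeff_eqI[of K 0] by (auto simp: xy_support_eq simp del: split_paired_Ex)
  then obtain u where u: "u \<in> xy_support K" and max: "wdeg q u = Max (wdeg q ` xy_support K)"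
    by (metis (no_types, lifting) Max_in finite_imageI finite_xy_support image_iff image_is_empty)
  define c where "c = xy_coeff K u"
  have c: "c \<noteq> 0" using u by (simp add: c_def xy_support_eq)
  have u': "u \<in> reduced_monoms q" using u K(1) by (auto simp: reduced_def)
  have "wmonic q u (scale_xy (inverse c) K)"
  proof (rule wmonicI)
    show "xy_coeff (scale_xy (inverse c) K) u = 1" using c by (simp add: c_def)
    fix v assume "v \<in> xy_support (scale_xy (inverse c) K)" and ne: "v \<noteq> u"
    then have v: "v \<in> xy_support K" by (auto simp: xy_support_eq)
    then have "wdeg q v \<le> wdeg q u" unfolding max by (intro Max_ge) auto
    moreover have "wdeg q v \<noteq> wdeg q u"
      using wdeg_inj_reduced[THEN inj_onD, of q v u] ne u' v K(1) by (auto simp: reduced_def)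
    ultimately show "wdeg q v < wdeg q u" by simp
  qed
  moreover have "K = scale_xy c (scale_xy (inverse c) K)" by (simp only: scale_xy_inverse(1)[OF c])
  ultimately show ?thesis using that c u u' by blast
qed

text \<open>
  In a nonzero multiple $gH$ the terms of $g$ with the largest exponent $R$ of $x$ produce terms with
  $x^{R+q+1}$ that nothing can cancel.
\<close>
lemma hermitian_multiple_reduced:
  fixes G :: "'a::field poly poly"
  assumes "hermitian_poly q dvd G" "reduced q G" "2 \<le> q"
  shows "G = 0"
proof (rule ccontr)
  assume "G \<noteq> 0"
  then obtain g where g: "G = hermitian_poly q * g" "g \<noteq> 0" using assms(1) by auto
  have ne: "xy_support g \<noteq> {}" using g(2) xy_coeff_eqI[of g 0] by (auto simp: xy_support_eq simp del: split_paired_Ex)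
  define R where "R = Max (fst ` xy_support g)"
  have "R \<in> fst ` xy_support g" unfolding R_def using ne by (intro Max_in finite_imageI finite_xy_support) simp
  then obtain S where RS: "(R, S) \<in> xy_support g" by (auto simp del: split_paired_Ex)
  have zero: "xy_coeff g (r, s) = 0" if "R < r" for r s
  proof (rule ccontr)
    assume "xy_coeff g (r, s) \<noteq> 0"
    then have "(r, s) \<in> xy_support g" by (simp add: xy_support_eq)
    then have "r \<le> R" unfolding R_def by (intro Max_ge) force+
    then show False using that by simp
  qed
  have "G = xy_monom (q + 1, 0) * g - xy_monom (0, q) * g - xy_monom (0, 1) * g"
    unfolding g hermitian_poly_def by (simp add: algebra_simps)
  then have "xy_coeff G (R + (q + 1), S) = xy_coeff g (R, S)"
    by (simp only: xy_coeff_diff xy_coeff_monom_mult) (simp add: zero)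
  then have "(R + (q + 1), S) \<in> xy_support G" using RS by (simp add: xy_support_eq)
  then show False using assms(2) by (auto simp: reduced_def reduced_monoms_def)
qed

text \<open>
  The corner is not standard, which provides $F$. Every other leading weight is the weight of a multiple of
  the corner, so elements of the vanishing ideal can be reduced to zero by multiples of $F$ and $H$, the weight
  dropping in each step.
\<close>
lemma vanishing_ideal_cut:
  fixes D :: "('a::field \<times> 'a) set"
  assumes q: "2 \<le> q" and D: "D \<subseteq> hermitian_points q" and \<mu>: "\<mu> \<le> q"
    and foot: "footprint q D = staircase q (\<mu>, l)"
  obtains F where "cut_on_hermitian q D F" "is_LM F (\<mu>, l)"
proof -
  have red: "(\<mu>, l) \<in> reduced_monoms q" using \<mu> by (simp add: reduced_monoms_def)
  have "(\<mu>, l) \<notin> staircase q (\<mu>, l)" by (simp add: staircase_def)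
  then have "leads q D (\<mu>, l)" using red foot unfolding footprint_def by blast
  then obtain v F where F: "v \<in> reduced_monoms q" "wdeg q v = wdeg q (\<mu>, l)" "reduced q F" "wmonic q v F"
    "F \<in> vanishing_ideal D" using leads_reduced_witness[OF q D] by blast
  have v: "v = (\<mu>, l)" using wdeg_inj_reduced[THEN inj_onD, of q v "(\<mu>, l)"] F red by simp
  let ?I = "ideal_gen {hermitian_poly q, F}"
  have "f \<in> ?I" if "f \<in> vanishing_ideal D" "wdeg_below q t f" for f t
    using that
  proof (induction t arbitrary: f)
    case 0
    then have "f = 0" by (intro xy_coeff_eqI) (auto simp: wdeg_below_def simp del: split_paired_All)
    then show ?case using ideal_gen_mult[OF ideal_gen_base, of F _ 0] by simp
  next
    case (Suc t)
    obtain G where G: "reduced q G" "wdeg_below q (Suc t) G" "hermitian_poly q dvd (f - G)"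
      using poly_reduction[OF q Suc.prems(2)] by blast
    have "f - (f - G) \<in> vanishing_ideal D"
      by (intro vanishing_ideal_diff Suc hermitian_multiple_vanishes[OF D] G)
    then have GI: "G \<in> vanishing_ideal D" by simp
    have fG: "f - G \<in> ?I" by (rule ideal_gen_dvd[OF _ G(3)]) simp
    have "G \<in> ?I"
    proof (cases "wdeg_below q t G")
      case True
      then show ?thesis using Suc.IH GI by blast
    next
      case False
      then have "G \<noteq> 0" by auto
      then obtain c u K where K: "c \<noteq> 0" "u \<in> reduced_monoms q" "u \<in> xy_support G" "wmonic q u K" "G = scale_xy c K"
        using reduced_normalize[OF G(1)] by blast
      have "K = scale_xy (inverse c) G" by (simp only: K(5) scale_xy_inverse(2)[OF K(1)])
      then have KI: "K \<in> vanishing_ideal D" "reduced q K" using GI G(1) by (simp_all add: vanishing_ideal_scale reduced_scale)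
      then have "u \<notin> staircase q (\<mu>, l)" using K(4) unfolding foot[symmetric] footprint_def leads_def by blast
      then obtain w where w: "wdeg q u = wdeg q ((\<mu>, l) + w)" using multiple_if_not_in_staircase[OF \<mu> K(2)] by blast
      have "wmonic q ((\<mu>, l) + w) (F * xy_monom w)" using wmonic_mult[OF F(4) wmonic_monom] v by simp
      \<comment> \<open>The multiple of $F$ that cancels the leading term $x^u$ of $G$, in reduced form.\<close>
      then obtain x M where M: "x \<in> reduced_monoms q" "wdeg q x = wdeg q ((\<mu>, l) + w)" "reduced q M" "wmonic q x M"
          "hermitian_poly q dvd (F * xy_monom w - M)" using wmonic_reduction[OF q] by blast
      have x: "x = u" using wdeg_inj_reduced[THEN inj_onD, of q x u] M K w by simp
      have ut: "wdeg q u \<le> t" using G(2) K(3) unfolding wdeg_below_def xy_support_eq by (metis less_Suc_eq_le mem_Collect_eq)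
      have M': "F * xy_monom w - M \<in> ?I" by (rule ideal_gen_dvd[OF _ M(5)]) simp
      have FI: "F * xy_monom w \<in> ?I" using ideal_gen_mult[OF ideal_gen_base, of F _ "xy_monom w"] by (simp add: mult.commute)
      have MI: "M \<in> ?I" using ideal_gen_diff[OF FI M'] by simp
      have "F * xy_monom w - (F * xy_monom w - M) \<in> vanishing_ideal D"
        using vanishing_ideal_diff[OF _ hermitian_multiple_vanishes[OF D M(5)]]
          vanishing_ideal_mult[OF F(5), of "xy_monom w"] by (simp only: mult.commute)
      then have "K - M \<in> vanishing_ideal D" using KI by (simp add: vanishing_ideal_diff)
      moreover have "wdeg_below q (wdeg q u) ((K - xy_monom u) - (M - xy_monom u))"
        using wdeg_below_diff[OF K(4)[unfolded wmonic_def] M(4)[unfolded wmonic_def x]] by simp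
      then have "wdeg_below q t (K - M)" using wdeg_below_mono[OF _ ut] by simp
      ultimately have "K - M \<in> ?I" using Suc.IH by blast
      then have "K \<in> ?I" using ideal_gen_add[OF _ MI] by fastforce
      then show ?thesis unfolding K(5) by (rule ideal_gen_scale)
    qed
    then show ?case using ideal_gen_add[OF fG] by fastforce
  qed
  then have "vanishing_ideal D \<subseteq> ?I" using ex_wdeg_below by blast
  moreover have "?I \<subseteq> vanishing_ideal D"
  proof
    fix f assume "f \<in> ?I"
    then obtain g h where "f = g * hermitian_poly q + h * F" by (auto simp: mem_ideal_gen_pair)
    then show "f \<in> vanishing_ideal D"
      using hermitian_multiple_vanishes[OF D, of "g * hermitian_poly q"] vanishing_ideal_mult[OF F(5)]
      by (simp add: vanishing_ideal_add)
  qed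
  ultimately have "cut_on_hermitian q D F" by (auto simp: cut_on_hermitian_def)
  moreover have "is_LM F (\<mu>, l)" using is_LM_if_wmonic[OF red F(3)] F(4) v by simp
  ultimately show ?thesis using that by blast
qed

text \<open>
  Every element of the ideal is congruent modulo $H$ to a multiple $KF$ with $K$ reduced. Since weights
  add under multiplication, its leading weight is that of a multiple of $x^\<mu> y^l$. Passing to reduced
  forms loses nothing, because a reduced multiple of $H$ is zero.
\<close>
lemma cut_footprint:
  fixes D :: "('a::field \<times> 'a) set"
  assumes q: "2 \<le> q" and D: "D \<subseteq> hermitian_points q" and \<mu>: "\<mu> \<le> q"
    and cut: "cut_on_hermitian q D F" and LM: "is_LM F (\<mu>, l)"
  shows "footprint q D = staircase q (\<mu>, l)"
proof
  have red: "(\<mu>, l) \<in> reduced_monoms q" using \<mu> by (simp add: reduced_monoms_def)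
  define F0 where "F0 = scale_xy (inverse (xy_coeff F (\<mu>, l))) F"
  have F0: "wmonic q (\<mu>, l) F0" "xy_coeff F (\<mu>, l) \<noteq> 0"
    using is_LM_imp_wmonic[OF LM red] by (simp_all add: F0_def)
  have FF0: "F = scale_xy (xy_coeff F (\<mu>, l)) F0" by (simp only: F0_def scale_xy_inverse(1)[OF F0(2)])
  have "F \<in> vanishing_ideal D" using cut ideal_gen_base[of F "{hermitian_poly q, F}"] by (simp add: cut_on_hermitian_def)
  then have "F0 \<in> vanishing_ideal D" unfolding F0_def by (rule vanishing_ideal_scale)
  then have "leads q D (\<mu>, l)" using F0 by (auto simp: leads_def)
  then show "footprint q D \<subseteq> staircase q (\<mu>, l)" by (rule footprint_subset_staircase[OF q D \<mu>])
  show "staircase q (\<mu>, l) \<subseteq> footprint q D"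
  proof
    fix u assume u: "u \<in> staircase q (\<mu>, l)"
    then have ur: "u \<in> reduced_monoms q" using staircase_subset_reduced by blast
    have "\<not> leads q D u"
    proof
      assume "leads q D u"
      then obtain v G where G: "v \<in> reduced_monoms q" "wdeg q v = wdeg q u" "reduced q G" "wmonic q v G"
        "G \<in> vanishing_ideal D" using leads_reduced_witness[OF q D] by blast
      have v: "v = u" using wdeg_inj_reduced[THEN inj_onD, of q v u] G ur by simp
      obtain g h where gh: "G = g * hermitian_poly q + h * F"
        using G(5) cut unfolding cut_on_hermitian_def mem_ideal_gen_pair[symmetric] by (auto simp: mem_ideal_gen_pair)
      define h' where "h' = scale_xy (xy_coeff F (\<mu>, l)) h"
      have G': "G - h' * F0 = g * hermitian_poly q" unfolding gh h'_def by (subst FF0) simp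
      obtain t where "wdeg_below q t h'" using ex_wdeg_below by blast
      then obtain K where K: "reduced q K" "hermitian_poly q dvd (h' - K)" using poly_reduction[OF q] by blast
      have "G - K * F0 = g * hermitian_poly q + (h' - K) * F0" using G' by (simp add: algebra_simps)
      then have GK: "hermitian_poly q dvd (G - K * F0)" using K(2) by (simp only:) (intro dvd_add dvd_triv_right dvd_mult2)
      have G0: "xy_coeff G u = 1" using wmonic_coeff[OF G(4)] v by simp
      have "K \<noteq> 0"
      proof
        assume "K = 0"
        then have "G = 0" using hermitian_multiple_reduced[OF _ G(3) q] GK by simp
        then show False using G0 by simp
      qed
      then obtain c w K' where K': "c \<noteq> 0" "w \<in> reduced_monoms q" "wmonic q w K'" "K = scale_xy c K'"
        using reduced_normalize[OF K(1)] by blast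
      obtain x M where M: "x \<in> reduced_monoms q" "wdeg q x = wdeg q (w + (\<mu>, l))" "reduced q M" "wmonic q x M"
          "hermitian_poly q dvd (K' * F0 - M)" using wmonic_reduction[OF q wmonic_mult[OF K'(3) F0(1)]] by blast
      have "G - scale_xy c M = (G - K * F0) + scale_xy c (K' * F0 - M)"
        unfolding K'(4) by (simp add: smult_diff_right)
      then have "hermitian_poly q dvd (G - scale_xy c M)" by (simp only:) (intro dvd_add GK dvd_smult M)
      then have GM: "G = scale_xy c M"
        using hermitian_multiple_reduced[OF _ reduced_diff[OF G(3) reduced_scale[OF M(3)]] q] by (metis eq_iff_diff_eq_0)
      have "xy_coeff M u \<noteq> 0" using G0 GM by auto
      then have "wdeg q u \<le> wdeg q x" using wmonic_support[OF M(4), of u] by (cases "u = x") (auto simp: xy_support_eq)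
      moreover have "xy_coeff G x \<noteq> 0" using GM wmonic_coeff[OF M(4)] K'(1) by simp
      then have "wdeg q x \<le> wdeg q u" using wmonic_support[OF G(4), of x] v by (cases "u = x") (auto simp: xy_support_eq)
      ultimately have "wdeg q u = wdeg q ((\<mu>, l) + w)" using M(2) by (simp add: add.commute)
      then show False using not_multiple_if_in_staircase[OF \<mu> u K'(2)] by simp
    qed
    then show "u \<in> footprint q D" using ur by (simp add: footprint_def)
  qed
qed

section \<open>Norm and trace, and rational points on lines\<close>

lemma primepow_ge_2: "primepow q \<Longrightarrow> 2 \<le> q" for q :: nat
  using primepow_gt_Suc_0[of q] by simp

text \<open>
  If $b$ values with at most $c$ preimages each are to cover $bc$ elements, no fibre can be smaller.
\<close>
lemma card_fiber_eq_if_tight: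
  fixes f :: "'b \<Rightarrow> 'c"
  assumes fin: "finite A" "finite B" and f: "f ` A \<subseteq> B"
    and B: "card B \<le> b" and fib: "\<And>y. y \<in> B \<Longrightarrow> card {x \<in> A. f x = y} \<le> c"
    and A: "card A = b * c" and y: "y \<in> B"
  shows "card {x \<in> A. f x = y} = c"
proof -
  have sum: "card A = (\<Sum>y\<in>B. card {x \<in> A. f x = y})"
    using sum.group[OF fin f, of "\<lambda>_. 1 :: nat"] by simp
  have le: "card B * c \<le> b * c" using B by simp
  show ?thesis
  proof (rule ccontr)
    assume "card {x \<in> A. f x = y} \<noteq> c"
    then have "\<exists>y\<in>B. card {x \<in> A. f x = y} < c" using fib[OF y] y by (intro bexI[of _ y]) auto
    then have "(\<Sum>y\<in>B. card {x \<in> A. f x = y}) < (\<Sum>y\<in>B. c)"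
      using fib by (intro sum_strict_mono_ex1 fin) auto
    then show False using sum A le by simp
  qed
qed

text \<open>
  The subfield with $q$ elements of a field with $q^2$ elements.
\<close>
definition fixed_field :: "nat \<Rightarrow> 'a::monoid_mult set" where
  "fixed_field q = {z. z ^ q = z}"

context
  fixes q :: nat
  assumes q: "primepow q" and card_field: "CARD('a::{field,finite}) = q^2"
begin

lemma q_ge_2: "2 \<le> q"
  by (rule primepow_ge_2[OF q])

text \<open>
  Multiplication by a nonzero $x$ permutes the nonzero elements; compare the products.
\<close>
lemma power_field_order: "x ^ (q^2) = x" for x :: 'a
proof (cases "x = 0")
  case True
  then show ?thesis using q_ge_2 by simp
next
  case False
  let ?U = "UNIV - {0 :: 'a}"
  have "\<Prod>?U = (\<Prod>y\<in>?U. x * y)"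
    by (rule prod.reindex_bij_witness[of _ "\<lambda>y. x * y" "\<lambda>y. y / x"]) (use False in auto)
  also have "\<dots> = x ^ (q^2 - 1) * \<Prod>?U"
    by (simp add: prod.distrib card_Diff_singleton card_field)
  finally have "x ^ (q^2 - 1) = 1" by simp
  moreover have "q^2 = Suc (q^2 - 1)" using q_ge_2 by simp
  ultimately show ?thesis by (metis mult.right_neutral power_Suc)
qed

text \<open>
  Summing $x+1$ over the field shows that the characteristic divides $q^2$, so $q$ is a power of it.
\<close>
lemma frobenius_add: "(x + y) ^ q = x ^ q + y ^ q" for x y :: 'a
proof -
  obtain p k where p: "prime p" "q = p ^ k" using q by (auto simp: primepow_def)
  have "(\<Sum>x\<in>(UNIV :: 'a set). x + 1) = (\<Sum>x\<in>(UNIV :: 'a set). x)"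
    by (rule sum.reindex_bij_witness[of _ "\<lambda>x. x - 1" "\<lambda>x. x + 1"]) auto
  then have "(of_nat (q^2) :: 'a) = 0" by (simp add: sum.distrib card_field flip: of_nat_power)
  then have dvd: "CHAR('a) dvd p ^ (k * 2)"
    by (simp add: of_nat_eq_0_iff_char_dvd p(2) power_mult del: of_nat_power)
  have pr: "prime CHAR('a)" by (intro prime_CHAR_semidom finite_imp_CHAR_pos) simp
  then have "CHAR('a) = p" using dvd p(1) by (metis prime_dvd_power primes_dvd_imp_eq)
  then show ?thesis using freshmans_dream'[OF pr, of q k x y] p(2) by simp
qed

lemma card_roots_le:
  fixes f :: "'a poly"
  assumes "f \<noteq> 0" "degree f \<le> n"
  shows "card {x. poly f x = 0} \<le> n"
  using card_poly_roots_bound[of f] assms by simp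

lemma trace_fiber_le: "card {y :: 'a. y ^ q + y = z} \<le> q"
proof -
  let ?f = "monom 1 q + monom 1 1 - [:z:]"
  have "coeff ?f q = 1" using q_ge_2 by (simp add: coeff_pCons split: nat.split)
  then have "?f \<noteq> 0" by (metis coeff_0 zero_neq_one)
  moreover have "degree ?f \<le> q"
    using q_ge_2 by (intro degree_diff_le degree_add_le order.trans[OF degree_monom_le]) auto
  ultimately have "card {x. poly ?f x = 0} \<le> q" by (rule card_roots_le)
  then show ?thesis by (simp add: poly_monom)
qed

lemma norm_fiber_le: "card {x :: 'a. x ^ (q + 1) = z} \<le> q + 1"
proof -
  let ?f = "monom 1 (q + 1) - [:z:]"
  have "coeff ?f (q + 1) = 1" by (simp add: coeff_pCons split: nat.split)
  then have "?f \<noteq> 0" by (metis coeff_0 zero_neq_one)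
  moreover have "degree ?f \<le> q + 1"
    by (intro degree_diff_le order.trans[OF degree_monom_le]) auto
  ultimately have "card {x. poly ?f x = 0} \<le> q + 1" by (rule card_roots_le)
  then show ?thesis by (simp add: poly_monom)
qed

lemma card_fixed_field_le: "card (fixed_field q :: 'a set) \<le> q"
proof -
  let ?f = "monom 1 q - monom 1 1 :: 'a poly"
  have "coeff ?f q = 1" using q_ge_2 by simp
  then have "?f \<noteq> 0" by (metis coeff_0 zero_neq_one)
  moreover have "degree ?f \<le> q"
    using q_ge_2 by (intro degree_diff_le order.trans[OF degree_monom_le]) auto
  ultimately have "card {x. poly ?f x = 0} \<le> q" by (rule card_roots_le)
  then show ?thesis by (simp add: poly_monom fixed_field_def)
qed

lemma trace_mem_fixed_field: "y ^ q + y \<in> fixed_field q" for y :: 'a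
  using power_field_order[of y] by (simp add: fixed_field_def frobenius_add power2_eq_square flip: power_mult)

lemma norm_mem_fixed_field: "x ^ (q + 1) \<in> fixed_field q" for x :: 'a
proof -
  have "(x ^ (q + 1)) ^ q = x ^ (q^2) * x ^ q"
    by (simp add: power2_eq_square algebra_simps flip: power_mult power_add)
  also have "\<dots> = x ^ (q + 1)" by (simp add: power_field_order)
  finally show ?thesis by (simp only: fixed_field_def mem_Collect_eq)
qed

text \<open>
  There are at most $q$ traces, each with at most $q$ preimages, and together they cover $q^2$ elements.
\<close>
lemma card_trace_fiber: "z \<in> fixed_field q \<Longrightarrow> card {y :: 'a. y ^ q + y = z} = q"
  using card_fiber_eq_if_tight[of "UNIV :: 'a set" "fixed_field q" "\<lambda>y. y ^ q + y" q q z]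
    trace_mem_fixed_field trace_fiber_le card_fixed_field_le by (auto simp: card_field power2_eq_square)

lemma zero_mem_fixed_field: "(0 :: 'a) \<in> fixed_field q" and one_mem_fixed_field: "(1 :: 'a) \<in> fixed_field q"
  using q_ge_2 by (auto simp: fixed_field_def)

text \<open>
  The same count as for the trace: $q-1$ nonzero norms, each with at most $q+1$ preimages, cover the
  $q^2-1$ nonzero elements.
\<close>
lemma card_norm_fiber:
  assumes "z \<in> fixed_field q" "z \<noteq> 0"
  shows "card {x :: 'a. x ^ (q + 1) = z} = q + 1"
proof -
  have "card {x \<in> UNIV - {0 :: 'a}. x ^ (q + 1) = z} = q + 1"
  proof (rule card_fiber_eq_if_tight)
    show "card (fixed_field q - {0 :: 'a}) \<le> q - 1" using card_fixed_field_le zero_mem_fixed_field by (simp add: card_Diff_singleton)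
    show "card {x \<in> UNIV - {0 :: 'a}. x ^ (q + 1) = y} \<le> q + 1" for y
      by (rule order.trans[OF card_mono norm_fiber_le[of y]]) auto
    show "card (UNIV - {0 :: 'a}) = (q - 1) * (q + 1)"
      by (simp add: card_Diff_singleton card_field power2_eq_square algebra_simps)
    show "(\<lambda>x. x ^ (q + 1)) ` (UNIV - {0 :: 'a}) \<subseteq> fixed_field q - {0}" using norm_mem_fixed_field by auto
  qed (use assms in auto)
  moreover have "{x \<in> UNIV - {0 :: 'a}. x ^ (q + 1) = z} = {x. x ^ (q + 1) = z}" using assms(2) by auto
  ultimately show ?thesis by simp
qed

lemma wmonic_linear_prods:
  fixes A :: "'a set"
  shows "wmonic q (card A, 0) (\<Prod>a\<in>A. xy_monom (1, 0) - scale_xy a (xy_monom (0, 0)))" (is ?X)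
    and "wmonic q (0, card A) (\<Prod>a\<in>A. xy_monom (0, 1) - scale_xy a (xy_monom (0, 0)))" (is ?Y)
proof -
  have one: "1 = (xy_monom (0, 0) :: 'a poly poly)" by (simp add: xy_monom_def one_pCons monom_0)
  have low: "wdeg_below q t (0 - scale_xy a (xy_monom (0, 0)))" if "0 < t" for t and a :: 'a
    by (intro wdeg_below_diff wdeg_below_0 wdeg_below_scale wdeg_below_monom) (use that in \<open>simp add: wdeg_def\<close>)
  have x: "wmonic q (1, 0) (xy_monom (1, 0) - scale_xy a (xy_monom (0, 0)))"
    and y: "wmonic q (0, 1) (xy_monom (0, 1) - scale_xy a (xy_monom (0, 0)))" for a :: 'a
    using q_ge_2 low[of "wdeg q (1, 0)" a] low[of "wdeg q (0, 1)" a]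
    by (simp_all add: wmonic_def wdeg_def)
  have "finite A" by simp
  then show ?X
  proof induction
    case empty
    show ?case using wmonic_monom by (simp add: one)
  next
    case (insert a A)
    then show ?case using wmonic_mult[OF x[of a] insert.IH] by simp
  qed
  have "finite A" by simp
  then show ?Y
  proof induction
    case empty
    show ?case using wmonic_monom by (simp add: one)
  next
    case (insert a A)
    then show ?case using wmonic_mult[OF y[of a] insert.IH] by simp
  qed
qed

text \<open>
  Take $\<mu>$ vertical lines $x = \<alpha>$ with $\<alpha>$ of a common norm $\<nu>$, and $l$ horizontal
  lines whose trace is neither $0$ nor $\<nu>$. Each vertical line carries $q$ rational points and each
  horizontal one $q+1$, and a common point on the curve would have norm $\<nu>$ equal to its trace. For $\<mu> \<le> 1$ the
  choice $\<nu> = 0$ leaves $q^2-q$ horizontal lines; for larger $\<mu>$ take $\<nu> = 1$, which has $q+1$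
  elements of that norm and leaves $q^2-2q$ lines.
\<close>
lemma exists_extremal_divisor:
  assumes range: "\<mu> \<le> 1 \<and> l \<le> q^2 - q \<or> \<mu> \<le> q \<and> l \<le> q^2 - 2 * q"
  obtains D :: "('a \<times> 'a) set" where "D \<subseteq> hermitian_points q" "card D = wdeg q (\<mu>, l)" "leads q D (\<mu>, l)"
proof -
  define \<nu> :: 'a where "\<nu> = (if \<mu> \<le> 1 then 0 else 1)"
  have \<nu>: "\<nu> \<in> fixed_field q" by (simp add: \<nu>_def zero_mem_fixed_field one_mem_fixed_field)
  have "\<mu> \<le> card {x :: 'a. x ^ (q + 1) = \<nu>}"
  proof (cases "\<mu> \<le> 1")
    case True
    then have "{x :: 'a. x ^ (q + 1) = \<nu>} = {0}" by (auto simp: \<nu>_def)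
    then show ?thesis using True by simp
  next
    case False
    then show ?thesis using card_norm_fiber[OF \<nu>] range by (simp add: \<nu>_def)
  qed
  then obtain A where A: "A \<subseteq> {x. x ^ (q + 1) = \<nu>}" "card A = \<mu>"
    by (meson obtain_subset_with_card_n)
  have "l \<le> card {y :: 'a. y ^ q + y \<notin> {0, \<nu>}}"
  proof -
    have eq: "{y :: 'a. y ^ q + y \<notin> {0, \<nu>}} = UNIV - ({y. y ^ q + y = 0} \<union> {y. y ^ q + y = \<nu>})" by auto
    show ?thesis
    proof (cases "\<mu> \<le> 1")
      case True
      have "l \<le> q^2 - q"
        using range by (elim disjE conjE) (auto elim: order.trans)
      then show ?thesis unfolding eq using True card_trace_fiber[OF zero_mem_fixed_field]
        by (simp add: \<nu>_def card_Diff_subset card_field)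
    next
      case False
      have "card ({y :: 'a. y ^ q + y = 0} \<union> {y. y ^ q + y = \<nu>}) \<le> 2 * q"
        using card_Un_le[of "{y :: 'a. y ^ q + y = 0}" "{y. y ^ q + y = \<nu>}"]
          card_trace_fiber[OF zero_mem_fixed_field] card_trace_fiber[OF \<nu>] by simp
      moreover have "l \<le> q^2 - 2 * q" using range False by simp
      ultimately show ?thesis unfolding eq by (simp add: card_Diff_subset card_field)
    qed
  qed
  then obtain B where B: "B \<subseteq> {y. y ^ q + y \<notin> {0, \<nu>}}" "card B = l"
    by (meson obtain_subset_with_card_n)
  define D where "D = {(x, y). y ^ q + y = x ^ (q + 1) \<and> (x \<in> A \<or> y \<in> B)}"
  have D: "D \<subseteq> hermitian_points q" by (auto simp: D_def mem_hermitian_points)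
  have D_eq: "D = (SIGMA x:A. {y. y ^ q + y = \<nu>}) \<union> prod.swap ` (SIGMA y:B. {x. x ^ (q + 1) = y ^ q + y})"
    using A(1) unfolding D_def by (auto simp: image_iff)
  have "card D = card (SIGMA x:A. {y. y ^ q + y = \<nu>}) + card (prod.swap ` (SIGMA y:B. {x. x ^ (q + 1) = y ^ q + y}))"
    unfolding D_eq using B(1) by (intro card_Un_disjoint) auto
  also have "card (SIGMA x:A. {y. y ^ q + y = \<nu>}) = \<mu> * q"
    using card_trace_fiber[OF \<nu>] A(2) by (simp add: card_SigmaI)
  also have "card (prod.swap ` (SIGMA y:B. {x. x ^ (q + 1) = y ^ q + y})) = card (SIGMA y:B. {x. x ^ (q + 1) = y ^ q + y})"
    by (intro card_image) auto
  also have "\<dots> = (\<Sum>y\<in>B. card {x. x ^ (q + 1) = y ^ q + y})" by (rule card_SigmaI) auto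
  also have "\<dots> = (\<Sum>y\<in>B. q + 1)"
  proof (rule sum.cong[OF refl])
    fix y assume "y \<in> B"
    then have "y ^ q + y \<noteq> 0" using B(1) by auto
    then show "card {x. x ^ (q + 1) = y ^ q + y} = q + 1" by (rule card_norm_fiber[OF trace_mem_fixed_field])
  qed
  finally have card: "card D = wdeg q (\<mu>, l)" using B(2) by (simp add: wdeg_def)
  let ?F = "(\<Prod>a\<in>A. xy_monom (1, 0) - scale_xy a (xy_monom (0, 0))) *
    (\<Prod>a\<in>B. xy_monom (0, 1) - scale_xy a (xy_monom (0, 0)))"
  have "wmonic q (\<mu>, l) ?F"
    using wmonic_mult[OF wmonic_linear_prods(1)[of A] wmonic_linear_prods(2)[of B]] A(2) B(2) by simp
  moreover have "?F \<in> vanishing_ideal D"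
    unfolding vanishing_ideal_def D_def
    by (auto simp: eval_xy_prod eval_xy_monom prod_zero_iff)
  ultimately have "leads q D (\<mu>, l)" unfolding leads_def by blast
  then show ?thesis using that D card by blast
qed

end

section \<open>Minimum-weight codewords\<close>

lemma basis_monoms_subset_reduced: "basis_monoms q \<subseteq> reduced_monoms q"
  by (auto simp: basis_monoms_def reduced_monoms_def)

text \<open>
  For $\<mu> > 0$ one has $x^a y^b = x^{\<mu>-1} y^{\<beta>+1}$, and for $\<mu> = 0$ it is
  $x^q y^{\<beta>+1-q}$. The ranges for $l$ come from the shape of the monomial basis.
\<close>
lemma code_parameters:
  assumes q: "2 \<le> q" and m_lower: "2 * q^2 - 2 * q - 2 \<le> m"
    and ab: "(a, b) \<in> basis_monoms q" "wdeg q (a, b) = m + 1"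
    and mu_beta: "m = \<mu> * q + \<beta> * (q + 1)" "\<mu> \<le> q"
    and l_def: "l = \<beta> + 2 - q"
  shows "(\<mu>, l) = corner q (a, b)" "q \<le> \<beta> + 2"
    "\<mu> \<le> 1 \<and> l \<le> q^2 - q \<or> \<mu> \<le> q \<and> l \<le> q^2 - 2 * q"
proof -
  \<comment> \<open>Writing $q = k + 2$ removes the truncated subtractions.\<close>
  obtain k where k: "q = k + 2" using q by (metis add.commute le_Suc_ex)
  have red: "(a, b) \<in> reduced_monoms q" using ab(1) basis_monoms_subset_reduced by blast
  have m2: "2 * k * k + 6 * k + 2 \<le> m" using m_lower by (simp add: k power2_eq_square algebra_simps)
  have "(\<mu>, l) = corner q (a, b) \<and> q \<le> \<beta> + 2 \<and> (\<mu> = 0 \<and> a = q \<or> \<mu> = a + 1)"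
  proof (cases "\<mu> = 0")
    case True
    have "k + 1 \<le> \<beta>"
    proof (rule ccontr)
      assume "\<not> k + 1 \<le> \<beta>"
      then have "\<beta> * (q + 1) \<le> k * (q + 1)" by (intro mult_right_mono) auto
      then have "m \<le> k * k + 3 * k" using mu_beta True by (simp add: k algebra_simps)
      moreover have "k * k \<le> 2 * k * k" by simp
      ultimately show False using m2 by linarith
    qed
    then obtain j where j: "\<beta> = k + 1 + j" by (metis le_Suc_ex)
    have "wdeg q (a, b) = wdeg q (q, j)" using ab(2) mu_beta(1) True by (simp add: wdeg_def j k algebra_simps)
    then have "(a, b) = (q, j)"
      using wdeg_inj_reduced[THEN inj_onD, of q "(a, b)" "(q, j)"] red by (simp add: reduced_monoms_def)
    then show ?thesis using True by (simp add: corner_def l_def j k)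
  next
    case False
    then obtain n where n: "\<mu> = n + 1" by (metis Suc_eq_plus1 not0_implies_Suc)
    have "wdeg q (a, b) = wdeg q (n, \<beta> + 1)" using ab(2) mu_beta(1) n by (simp add: wdeg_def)
    then have "(a, b) = (n, \<beta> + 1)"
      using wdeg_inj_reduced[THEN inj_onD, of q "(a, b)" "(n, \<beta> + 1)"] red mu_beta(2) n
      by (simp add: reduced_monoms_def)
    moreover have "q \<le> \<beta> + 2"
    proof (rule ccontr)
      assume "\<not> q \<le> \<beta> + 2"
      then have \<beta>: "\<beta> + 1 \<le> k" by (simp add: k)
      then have "(\<beta> + 1) * (q + 1) \<le> k * (q + 1)" by (intro mult_right_mono) auto
      moreover have "\<mu> * q \<le> q * q" using mu_beta(2) by simp
      moreover have "m + (q + 1) = \<mu> * q + (\<beta> + 1) * (q + 1)" unfolding mu_beta(1) by (simp add: algebra_simps)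
      ultimately have "m + (q + 1) \<le> q * q + k * (q + 1)" by linarith
      then have "m \<le> 2 * (k * k) + 6 * k + 1" by (simp add: k algebra_simps)
      then show False using m2 by simp
    qed
    ultimately show ?thesis using n mu_beta(2) by (simp add: corner_def l_def)
  qed
  then have c: "(\<mu>, l) = corner q (a, b)" "q \<le> \<beta> + 2" "\<mu> = 0 \<and> a = q \<or> \<mu> = a + 1" by auto
  show "(\<mu>, l) = corner q (a, b)" "q \<le> \<beta> + 2" by fact+
  have q2: "q^2 = k * k + 4 * k + 4" by (simp add: k power2_eq_square algebra_simps)
  have bs: "a \<le> q \<and> b \<le> k * k + 3 * k + 1 \<or> a = 0 \<and> b \<le> k * k + 4 * k + 3"
    using ab(1) unfolding basis_monoms_def q2 by (auto simp: k)
  show "\<mu> \<le> 1 \<and> l \<le> q^2 - q \<or> \<mu> \<le> q \<and> l \<le> q^2 - 2 * q"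
    using c(3) c(1) bs mu_beta(2) unfolding q2 by (auto simp: corner_def k split: if_splits)
qed

context
  fixes q :: nat and P :: "'n::finite \<Rightarrow> 'a::{field,finite} \<times> 'a"
  assumes q: "primepow q" and card_field: "CARD('a) = q^2"
    and points: "bij_betw P UNIV (hermitian_points q)"
begin

text \<open>
  On the curve $x (y^q+y)^{q-1} = x \<cdot> x^{(q+1)(q-1)} = x^{q^2} = x$. Expanding the left-hand side
  expresses $x^{r+1} y^{s + q^2-q}$ through monomials with the same power of $x$ and a smaller power of $y$.
\<close>
lemma hermitian_binomial_relation:
  fixes x y :: 'a
  assumes "y ^ q + y = x ^ (q + 1)"
  shows "(\<Sum>k<q. of_nat ((q - 1) choose k) * (x ^ (r + 1) * y ^ (s + (q - 1) * (k + 1)))) = x ^ (r + 1) * y ^ s"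
proof -
  have exp: "(y ^ q) ^ k * y ^ (q - 1 - k) = y ^ ((q - 1) * (k + 1))" if "k < q" for k
  proof -
    obtain j where j: "q = k + 1 + j" using \<open>k < q\<close> by (metis Suc_eq_plus1 Suc_leI le_Suc_ex)
    have "q * k + (q - 1 - k) = (q - 1) * (k + 1)" by (simp add: j algebra_simps)
    then show ?thesis by (metis power_add power_mult)
  qed
  have "{..q - 1} = {..<q}" using primepow_ge_2[OF q] by auto
  then have "(y ^ q + y) ^ (q - 1) = (\<Sum>k<q. of_nat ((q - 1) choose k) * ((y ^ q) ^ k * y ^ (q - 1 - k)))"
    by (subst binomial_ring) (simp only: mult.assoc)
  also have "\<dots> = (\<Sum>k<q. of_nat ((q - 1) choose k) * y ^ ((q - 1) * (k + 1)))"
    by (rule sum.cong[OF refl]) (simp only: exp lessThan_iff)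
  finally have bin: "(y ^ q + y) ^ (q - 1) = (\<Sum>k<q. of_nat ((q - 1) choose k) * y ^ ((q - 1) * (k + 1)))" .
  have "x * (y ^ q + y) ^ (q - 1) = x ^ (1 + (q + 1) * (q - 1))"
    unfolding assms by (simp only: power_add power_mult power_one_right)
  also have "1 + (q + 1) * (q - 1) = q^2"
  proof -
    obtain k where "q = k + 1" using primepow_ge_2[OF q] by (metis Suc_eq_plus1 not0_implies_Suc not_numeral_le_zero)
    then show ?thesis by (simp add: power2_eq_square)
  qed
  also have "x ^ (q^2) = x" by (rule power_field_order[OF q card_field])
  finally have rel: "x * (y ^ q + y) ^ (q - 1) = x" .
  have "(\<Sum>k<q. of_nat ((q - 1) choose k) * (x ^ (r + 1) * y ^ (s + (q - 1) * (k + 1))))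
      = x ^ r * y ^ s * (x * (\<Sum>k<q. of_nat ((q - 1) choose k) * y ^ ((q - 1) * (k + 1))))"
    unfolding sum_distrib_left by (intro sum.cong[OF refl]) (simp only: power_add power_one_right mult_ac)
  also have "\<dots> = x ^ (r + 1) * y ^ s" unfolding bin[symmetric] rel by simp
  finally show ?thesis .
qed

definition pairing :: "'a ^ 'n \<Rightarrow> 'a poly poly \<Rightarrow> 'a" where
  "pairing c F = (\<Sum>i\<in>UNIV. c $ i * eval_xy F (P i))"

lemma point_on_curve: "snd (P i) ^ q + snd (P i) = fst (P i) ^ (q + 1)"
  using bij_betwE[OF points] mem_hermitian_points[of "fst (P i)" "snd (P i)" q] by simp

lemma eval_monom_point: "eval_xy (xy_monom (r, s)) (P i) = fst (P i) ^ r * snd (P i) ^ s"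
  using eval_xy_monom[of r s "fst (P i)" "snd (P i)"] by simp

lemma pairing_relation_x:
  "pairing c (xy_monom (r + 1, s)) =
    (\<Sum>k<q. of_nat ((q - 1) choose k) * pairing c (xy_monom (r + 1, s + (q - 1) * (k + 1))))"
proof -
  have "pairing c (xy_monom (r + 1, s)) = (\<Sum>i\<in>UNIV. \<Sum>k<q. of_nat ((q - 1) choose k) *
      (c $ i * eval_xy (xy_monom (r + 1, s + (q - 1) * (k + 1))) (P i)))"
    unfolding pairing_def eval_monom_point
  proof (rule sum.cong[OF refl])
    fix i
    show "c $ i * (fst (P i) ^ (r + 1) * snd (P i) ^ s) = (\<Sum>k<q. of_nat ((q - 1) choose k) *
       (c $ i * (fst (P i) ^ (r + 1) * snd (P i) ^ (s + (q - 1) * (k + 1)))))"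
      unfolding hermitian_binomial_relation[OF point_on_curve[of i], symmetric, of r s] sum_distrib_left
      by (intro sum.cong[OF refl]) (simp only: mult.left_commute)
  qed
  also have "\<dots> = (\<Sum>k<q. \<Sum>i\<in>UNIV. of_nat ((q - 1) choose k) *
      (c $ i * eval_xy (xy_monom (r + 1, s + (q - 1) * (k + 1))) (P i)))"
    by (rule sum.swap)
  finally show ?thesis unfolding pairing_def sum_distrib_left .
qed

lemma pairing_relation_y: "pairing c (xy_monom (r, s + q^2)) = pairing c (xy_monom (r, s + 1))"
  unfolding pairing_def eval_monom_point power_add power_field_order[OF q card_field] by simp

text \<open>
  The monomial basis may omit reduced monomials of weight at most $m$. As functions on the rational points
  these reduce to basis monomials with the same exponent of $x$ and a smaller exponent of $y$, through
  \<open>hermitian_binomial_relation\<close> if $x$ occurs and through $y^{q^2} = y$ otherwise.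
\<close>
lemma pairing_zero_if_basis:
  assumes basis: "\<And>u. u \<in> basis_monoms q \<Longrightarrow> wdeg q u \<le> m \<Longrightarrow> pairing c (xy_monom u) = 0"
    and "r \<le> q" "wdeg q (r, s) \<le> m"
  shows "pairing c (xy_monom (r, s)) = 0"
  using assms(3)
proof (induction s rule: less_induct)
  case (less s)
  have IH: "pairing c (xy_monom (r, s')) = 0" if "s' < s" for s'
  proof -
    have "s' * (q + 1) \<le> s * (q + 1)" using that by (intro mult_right_mono) auto
    then show ?thesis using less.IH[OF that] less.prems by (simp add: wdeg_def)
  qed
  show ?case
  proof (cases "(r, s) \<in> basis_monoms q")
    case True
    then show ?thesis using basis less.prems by blast
  next
    case nb: False
    obtain k where k: "q = k + 2" using primepow_ge_2[OF q] by (metis add.commute le_Suc_ex)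
    have q2: "q^2 = k * k + 4 * k + 4" by (simp add: k power2_eq_square algebra_simps)
    show ?thesis
    proof (cases "r = 0")
      case True
      then have "q^2 \<le> s" using nb unfolding basis_monoms_def q2 by (auto simp: k)
      then have s: "s = s - q^2 + q^2" by simp
      have "s - q^2 + 1 < s" using \<open>q^2 \<le> s\<close> unfolding q2 by linarith
      then have "pairing c (xy_monom (r, s - q^2 + 1)) = 0" by (rule IH)
      then show ?thesis using pairing_relation_y[of c r "s - q^2"] s by simp
    next
      case False
      then obtain r' where r': "r = r' + 1" by (metis Suc_eq_plus1 not0_implies_Suc)
      have "q^2 - q \<le> s" using nb assms(2) False unfolding basis_monoms_def q2 by (auto simp: k)
      then obtain s0 where s0: "s = s0 + (q^2 - q)" by (metis add.commute le_Suc_ex)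
      \<comment> \<open>The last of the $q$ terms of the relation is the monomial in question, all others are smaller.\<close>
      have top: "s0 + (q - 1) * ((q - 1) + 1) = s" unfolding s0 q2 by (simp add: k algebra_simps)
      have "s0 < s" unfolding s0 q2 by (simp add: k)
      have small: "s0 + (q - 1) * (j + 1) < s" if "j < q - 1" for j
        using that unfolding top[symmetric] by (intro add_strict_left_mono mult_strict_left_mono) auto
      have "{..<q} = insert (q - 1) {..<q - 1}" using primepow_ge_2[OF q] by auto
      then have "pairing c (xy_monom (r, s0)) = pairing c (xy_monom (r, s)) +
          (\<Sum>j<q - 1. of_nat ((q - 1) choose j) * pairing c (xy_monom (r, s0 + (q - 1) * (j + 1))))"
        using pairing_relation_x[of c r' s0] unfolding r' by (simp only:) (simp add: top[simplified])
      also have "(\<Sum>j<q - 1. of_nat ((q - 1) choose j) * pairing c (xy_monom (r, s0 + (q - 1) * (j + 1)))) = 0"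
        by (intro sum.neutral ballI) (simp only: IH small lessThan_iff mult_zero_right)
      finally show ?thesis using IH[OF \<open>s0 < s\<close>] by simp
    qed
  qed
qed

lemma mem_hermitian_code_iff:
  "c \<in> hermitian_code q P m \<longleftrightarrow> (\<forall>u\<in>reduced_monoms q. wdeg q u \<le> m \<longrightarrow> pairing c (xy_monom u) = 0)"
proof
  assume c: "c \<in> hermitian_code q P m"
  have "pairing c (xy_monom u) = 0" if "u \<in> basis_monoms q" "wdeg q u \<le> m" for u
  proof -
    have "(\<chi> i. eval_xy (xy_monom u) (P i)) \<in> vec.span ((\<lambda>u. \<chi> i. eval_xy (xy_monom u) (P i)) ` basis_monoms_upto q m)"
      using that by (intro vec.span_base) (auto simp: basis_monoms_upto_def)
    then have "(\<Sum>i\<in>UNIV. c $ i * (\<chi> i. eval_xy (xy_monom u) (P i)) $ i) = 0"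
      using c unfolding hermitian_code_def dual_code_def by blast
    then show ?thesis by (simp add: pairing_def)
  qed
  then show "\<forall>u\<in>reduced_monoms q. wdeg q u \<le> m \<longrightarrow> pairing c (xy_monom u) = 0"
    using pairing_zero_if_basis[of m c] unfolding reduced_monoms_def by blast
next
  assume c: "\<forall>u\<in>reduced_monoms q. wdeg q u \<le> m \<longrightarrow> pairing c (xy_monom u) = 0"
  show "c \<in> hermitian_code q P m"
    unfolding hermitian_code_def dual_code_def
  proof (intro CollectI ballI)
    fix v assume "v \<in> vec.span ((\<lambda>u. \<chi> i. eval_xy (xy_monom u) (P i)) ` basis_monoms_upto q m)"
    then show "(\<Sum>i\<in>UNIV. c $ i * v $ i) = 0"
    proof (induction rule: vec.span_induct_alt)
      case base
      then show ?case by simp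
    next
      case (step a x y)
      then obtain u where u: "u \<in> basis_monoms q" "wdeg q u \<le> m" "x = (\<chi> i. eval_xy (xy_monom u) (P i))"
        by (auto simp: basis_monoms_upto_def)
      then have "(\<Sum>i\<in>UNIV. c $ i * x $ i) = 0"
        using c basis_monoms_subset_reduced[of q] by (auto simp: pairing_def)
      moreover have "(\<Sum>i\<in>UNIV. c $ i * (a *s x + y) $ i) = a * (\<Sum>i\<in>UNIV. c $ i * x $ i) + (\<Sum>i\<in>UNIV. c $ i * y $ i)"
        by (simp add: sum.distrib sum_distrib_left algebra_simps)
      ultimately show ?case using step by simp
    qed
  qed
qed

lemma inj_points: "inj P"
  using points by (simp add: bij_betw_def)

lemma codeword_support_subset: "codeword_support P c \<subseteq> hermitian_points q"
  using points by (auto simp: codeword_support_def bij_betw_def)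

lemma card_codeword_support: "card (codeword_support P c) = weight c"
  unfolding codeword_support_def weight_def by (rule card_image) (rule inj_on_subset[OF inj_points], simp)

text \<open>
  A codeword is a functional on its support that kills all reduced monomials of weight at most $m$.
\<close>
lemma codeword_footprint_beyond:
  assumes c: "c \<in> hermitian_code q P m" "c \<noteq> 0"
  shows "\<exists>u\<in>footprint q (codeword_support P c). m < wdeg q u"
proof -
  let ?D = "codeword_support P c"
  define f where "f p = c $ inv P p" for p
  have f: "f (P i) = c $ i" for i by (simp add: f_def inv_f_f[OF inj_points])
  have sum: "(\<Sum>p\<in>?D. f p * eval_xy F p) = pairing c F" for F
  proof -
    have "(\<Sum>p\<in>?D. f p * eval_xy F p) = (\<Sum>i | c $ i \<noteq> 0. c $ i * eval_xy F (P i))"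
      unfolding codeword_support_def by (subst sum.reindex) (auto intro: inj_on_subset[OF inj_points] simp: f)
    also have "\<dots> = pairing c F" unfolding pairing_def by (rule sum.mono_neutral_left) auto
    finally show ?thesis .
  qed
  obtain i where i: "c $ i \<noteq> 0" using c(2) by (auto simp: vec_eq_iff)
  show ?thesis
  proof (rule footprint_beyond_if_orthogonal[where c = f])
    show "P i \<in> ?D" "f (P i) \<noteq> 0" using i by (auto simp: codeword_support_def f)
    show "(\<Sum>p\<in>?D. f p * eval_xy (xy_monom u) p) = 0" if "u \<in> reduced_monoms q" "wdeg q u \<le> m" for u
      unfolding sum using c(1) that by (simp add: mem_hermitian_code_iff)
  qed (rule primepow_ge_2[OF q] codeword_support_subset)+
qed

lemma weight_lower_bound:
  assumes m: "2 * q^2 - 2 * q - 2 \<le> m" and c: "c \<in> hermitian_code q P m" "c \<noteq> 0"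
  shows "m + 1 \<le> weight c + (q^2 - q - 1)"
proof -
  obtain u where u: "u \<in> footprint q (codeword_support P c)" "m < wdeg q u"
    using codeword_footprint_beyond[OF c] by blast
  then have "wdeg q u \<le> weight c + (q^2 - q - 1)"
    using wdeg_footprint_bound[OF primepow_ge_2[OF q] codeword_support_subset u(1)] m by (simp add: card_codeword_support)
  then show ?thesis using u(2) by simp
qed

lemma exists_codeword_with_support:
  assumes m: "2 * q^2 - 2 * q - 2 \<le> m"
    and D: "D \<subseteq> hermitian_points q"
    and u0: "u0 \<in> footprint q D" "wdeg q u0 = m + 1" and card: "card D = wdeg q (corner q u0)"
  obtains c where "c \<in> hermitian_code q P m" "codeword_support P c = D"
proof -
  obtain f where f: "\<And>p. p \<in> D \<Longrightarrow> f p \<noteq> 0"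
    "\<And>u. u \<in> reduced_monoms q \<Longrightarrow> wdeg q u \<le> m \<Longrightarrow> (\<Sum>p\<in>D. f p * eval_xy (xy_monom u) p) = 0"
    using full_support_functional[OF primepow_ge_2[OF q] D m u0 card] by blast
  define c :: "'a ^ 'n" where "c = (\<chi> i. if P i \<in> D then f (P i) else 0)"
  have supp: "{i. c $ i \<noteq> 0} = {i. P i \<in> D}" using f(1) by (auto simp: c_def)
  have DP: "D = P ` {i. P i \<in> D}" using D points image_vimage_eq[of P D] by (simp add: vimage_def bij_betw_def Int_absorb2)
  have "pairing c F = (\<Sum>p\<in>D. f p * eval_xy F p)" for F
  proof -
    have "pairing c F = (\<Sum>i | P i \<in> D. f (P i) * eval_xy F (P i))"
      unfolding pairing_def by (rule sum.mono_neutral_cong_right) (auto simp: c_def)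
    also have "\<dots> = (\<Sum>p\<in>P ` {i. P i \<in> D}. f p * eval_xy F p)"
      by (subst sum.reindex) (auto intro: inj_on_subset[OF inj_points])
    finally show ?thesis using DP by simp
  qed
  then have "c \<in> hermitian_code q P m" using f(2) by (simp add: mem_hermitian_code_iff)
  moreover have "codeword_support P c = D" unfolding codeword_support_def supp by (rule DP[symmetric])
  ultimately show ?thesis using that by blast
qed

end

theorem theorem5p1:
  fixes q m \<mu> \<beta> l a b :: nat
    and P :: "'n::finite \<Rightarrow> 'a::{field,finite} \<times> 'a"
  assumes q: "primepow q"
    and card_field: "CARD('a) = q^2"
    and points: "bij_betw P UNIV (hermitian_points q)"
    and m_lower: "2 * q^2 - 2 * q - 2 \<le> m"
    and m_upper: "m \<le> q^3 + q^2 - q - 2"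
    and ab: "(a, b) \<in> basis_monoms q" "wdeg q (a, b) = m + 1"
    and mu_beta: "m = \<mu> * q + \<beta> * (q + 1)" "\<mu> \<le> q"
    and l_def: "l = \<beta> + 2 - q"
  shows
    "(\<exists>!u. u \<in> basis_monoms q \<and> wdeg q u = m + 1) \<and>
     (\<exists>!(\<mu>', \<beta>'). m = \<mu>' * q + \<beta>' * (q + 1) \<and> \<mu>' \<le> q) \<and>
     q \<le> \<beta> + 2 \<and>
     code_distance (hermitian_code q P m) = \<mu> * q + l * (q + 1) \<and>
     (\<forall>D F. hermitian_divisor q D \<and> cut_on_hermitian q D F \<and> is_LM F (\<mu>, l) \<longrightarrow>
        (\<exists>c. min_weight_codeword (hermitian_code q P m) c \<and> codeword_support P c = D)) \<and>
     (\<forall>D. hermitian_divisor q D \<and>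
        (\<exists>c. min_weight_codeword (hermitian_code q P m) c \<and> codeword_support P c = D) \<longrightarrow>
          {u \<in> standard_monoms (initial_ideal (vanishing_ideal D)). m < wdeg q u} = {(a, b)} \<and>
          (\<exists>F. cut_on_hermitian q D F \<and> is_LM F (\<mu>, l)))"
proof (intro conjI allI impI)
  let ?C = "hermitian_code q P m" and ?d = "wdeg q (\<mu>, l)"
  note facts = q card_field points
  have q2: "2 \<le> q" by (rule primepow_ge_2[OF q])
  note param = code_parameters[OF q2 m_lower ab mu_beta l_def]
  have red: "(a, b) \<in> reduced_monoms q" using ab(1) basis_monoms_subset_reduced by blast
  have large: "2 * q^2 - 2 * q - 2 < wdeg q (a, b)" using m_lower ab(2) by simp
  have d: "?d + (q^2 - q - 1) = m + 1" using wdeg_corner(1)[OF q2 red large] param(1) ab(2) by simp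
  have bound: "?d \<le> weight c" if "c \<in> ?C - {0}" for c
    using weight_lower_bound[OF facts m_lower, of c] that d by simp
  have ab_foot: "(a, b) \<in> footprint q D" if "footprint q D = staircase q (\<mu>, l)" for D :: "('a \<times> 'a) set"
    using mem_staircase_corner[OF red] param(1) that by simp
  have codeword: "\<exists>c. c \<in> ?C - {0} \<and> weight c = ?d \<and> codeword_support P c = D"
    if D: "D \<subseteq> hermitian_points q" and foot: "footprint q D = staircase q (\<mu>, l)" for D
  proof -
    have card: "card D = ?d" using card_footprint(2)[OF q2 D] card_staircase(2)[OF mu_beta(2)] foot by simp
    obtain c where c: "c \<in> ?C" "codeword_support P c = D"
      using exists_codeword_with_support[OF facts m_lower D ab_foot[OF foot] ab(2)] card param(1) by auto
    have w: "weight c = ?d" using card_codeword_support[OF facts, of c] c(2) card by simp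
    have "D \<noteq> {}" using ab_foot[OF foot] card_footprint[OF q2 D] by auto
    then have "c \<noteq> 0" using c(2) by (auto simp: codeword_support_def)
    then show ?thesis using c w by blast
  qed
  obtain D0 :: "('a \<times> 'a) set" where D0: "D0 \<subseteq> hermitian_points q" "card D0 = ?d" "leads q D0 (\<mu>, l)"
    using exists_extremal_divisor[OF q card_field param(3)] by blast
  have "footprint q D0 = staircase q (\<mu>, l)"
    using card_subset_eq[OF card_staircase(1)[OF mu_beta(2)] footprint_subset_staircase[OF q2 D0(1) mu_beta(2) D0(3)]]
      card_footprint(2)[OF q2 D0(1)] card_staircase(2)[OF mu_beta(2)] D0(2) by simp
  then obtain c0 where c0: "c0 \<in> ?C - {0}" "weight c0 = ?d" using codeword[OF D0(1)] by blast
  have dist: "code_distance ?C = ?d"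
    unfolding code_distance_def by (rule cInf_eq_minimum) (use c0 bound in \<open>force+\<close>)
  then show "code_distance ?C = \<mu> * q + l * (q + 1)" by (simp add: wdeg_def)
  show "q \<le> \<beta> + 2" by (rule param(2))
  show "\<exists>!u. u \<in> basis_monoms q \<and> wdeg q u = m + 1"
  proof (rule ex1I[of _ "(a, b)"])
    fix u assume "u \<in> basis_monoms q \<and> wdeg q u = m + 1"
    then show "u = (a, b)"
      using wdeg_inj_reduced[THEN inj_onD, of q u "(a, b)"] red ab(2) basis_monoms_subset_reduced by auto
  qed (use ab in simp)
  show "\<exists>!(\<mu>', \<beta>'). m = \<mu>' * q + \<beta>' * (q + 1) \<and> \<mu>' \<le> q"
  proof (rule ex1I[of _ "(\<mu>, \<beta>)"])
    show "case (\<mu>, \<beta>) of (\<mu>', \<beta>') \<Rightarrow> m = \<mu>' * q + \<beta>' * (q + 1) \<and> \<mu>' \<le> q" using mu_beta by simp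
    fix u assume "case u of (\<mu>', \<beta>') \<Rightarrow> m = \<mu>' * q + \<beta>' * (q + 1) \<and> \<mu>' \<le> q"
    then have "u \<in> reduced_monoms q" "wdeg q u = m" by (auto simp: reduced_monoms_def wdeg_def)
    moreover have "(\<mu>, \<beta>) \<in> reduced_monoms q" "wdeg q (\<mu>, \<beta>) = m"
      using mu_beta by (auto simp: reduced_monoms_def wdeg_def)
    ultimately show "u = (\<mu>, \<beta>)" using wdeg_inj_reduced[THEN inj_onD, of q u "(\<mu>, \<beta>)"] by simp
  qed
  {
    fix D :: "('a \<times> 'a) set" and F
    assume "hermitian_divisor q D \<and> cut_on_hermitian q D F \<and> is_LM F (\<mu>, l)"
    then have D: "D \<subseteq> hermitian_points q" and cut: "cut_on_hermitian q D F" "is_LM F (\<mu>, l)"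
      by (auto simp: hermitian_divisor_def)
    have "footprint q D = staircase q (\<mu>, l)" by (rule cut_footprint[OF q2 D mu_beta(2) cut])
    then show "\<exists>c. min_weight_codeword ?C c \<and> codeword_support P c = D"
      using codeword[OF D] dist unfolding min_weight_codeword_def by metis
  }
  fix D :: "('a \<times> 'a) set"
  assume "hermitian_divisor q D \<and> (\<exists>c. min_weight_codeword ?C c \<and> codeword_support P c = D)"
  then obtain c where D: "D \<subseteq> hermitian_points q" and c: "c \<in> ?C" "c \<noteq> 0" "weight c = ?d" "codeword_support P c = D"
    by (auto simp: hermitian_divisor_def min_weight_codeword_def dist)
  have card: "card D = wdeg q (corner q (a, b))"
    using card_codeword_support[OF facts, of c] c param(1) by simp
  have "\<exists>u\<in>footprint q D. m < wdeg q u" using codeword_footprint_beyond[OF facts c(1,2)] c(4) by simp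
  note foot = footprint_of_extremal_support[OF q2 D m_lower red ab(2) card this]
  show "{u \<in> standard_monoms (initial_ideal (vanishing_ideal D)). m < wdeg q u} = {(a, b)}"
    using foot(2) by (simp only: standard_monoms_eq_footprint[OF q2 D])
  have "footprint q D = staircase q (\<mu>, l)" using foot(1) param(1) by simp
  then show "\<exists>F. cut_on_hermitian q D F \<and> is_LM F (\<mu>, l)"
    using vanishing_ideal_cut[OF q2 D mu_beta(2)] by blast
qed

end
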